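(* Let $Q$ and $I$ be multiplicative Lie algebras and let $\chi=\{\sigma,\tau,\nu\}$ be action terms for $(Q,I)$ which are realized by some extension of $I$ by $Q$. Then the abelian second cohomology group $H^{2}(Q,\zeta(I),\chi_{\zeta(I)})$ and the set $\mathrm{Ext}_{\chi}(Q,I)$ are in bijective correspondence.
   Context: A multiplicative Lie algebra is a group $\langle A,\cdot,1\rangle$ with a binary operation $\{\,,\}$ such that, with $x^{z}:=zxz^{-1}$, for all $x,y,z$: $\{x,x\}=1$; $\{x,yz\}=\{x,y\}\{x,z\}^{y}$; $\{xy,z\}=\{y,z\}^{x}\{x,z\}$; $\{\{x,y\},z^{y}\}\{\{y,z\},x^{z}\}\{\{z,x\},y^{x}\}=1$; $\{x,y\}^{z}=\{x^{z},y^{z}\}$. Homomorphisms and automorphisms preserve the group operation and the bracket. The algebraic center is $\zeta(I)=\{a\in I: ab=ba \text{ and } \{a,b\}=\{b,a\}=1 \text{ for all } b\in I\}$; it is an ideal with commutative group operation (written additively) and trivial bracket. Action terms for $(Q,I)$: $\chi=\{\sigma,\tau,\nu\}$ with $\sigma:Q\to\mathrm{Aut}\,I$, $\tau:Q\times I\to I$, $\nu:I\times Q\to I$ functions, written $\sigma_x(a),\tau_x(a),\nu_x(a)$, with $\tau_x(1)=\nu_x(1)=1$. An extension of $I$ by $Q$ is an exact sequence $1\to I\xrightarrow{i}A\xrightarrow{\pi}Q\to1$ of multiplicative Lie algebras. Two extensions $A,A'$ (with maps $i,\pi$ and $i',\pi'$) are equivalent if there is an isomorphism $\lambda:A\to A'$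 with $\lambda i=i'$ and $\pi'\lambda=\pi$; $[A]$ is the equivalence class. A section is a map $l:Q\to A$ with $\pi l=\mathrm{id}_Q$ and $l(1)=1$. Identifying $I$ with $i(I)$, a section $l$ determines action terms $\chi^{l}$ by $\sigma^{l}_x(a)=l(x)\,a\,l(x)^{-1}$, $\tau^{l}_x(a)=\{l(x),a\}$, $\nu^{l}_x(a)=\{a,l(x)\}$. Action terms $\chi,\chi'$ for $(Q,I)$ are equivalent, $\chi\sim\chi'$, if there is a map $h:Q\to I$ such that for all $x\in Q$, $a\in I$: $\sigma_x(a)=h(x)\sigma'_x(a)h(x)^{-1}$, $\tau_x(a)=\tau'_x(a)^{h(x)}\{h(x),a\}$, $\nu_x(a)=\{a,h(x)\}\nu'_x(a)^{h(x)}$. An extension realizes the action terms $\chi$ if it has a section $l$ with $\chi=\chi^{l}$; it realizes the class $[\chi]$ if it has a section $l$ with $\chi^{l}\sim\chi$. $\mathrm{Ext}_{\chi}(Q,I)$ is the set of equivalence classes of extensions of $I$ by $Q$ realizing $[\chi]$. When $\chi$ is realized by an extension, $\zeta(I)$ is closed under $\sigma_x,\tau_x,\nu_x$, and $\chi_{\zeta(I)}$ denotes the action terms for $(Q,\zeta(I))$ obtained by restriction. Abelian second cohomology. Let $B$ be an abelian multiplicative Lie algebra (commutative group, written additively, trivial bracket) with action terms $\chi=\{\sigma,\tau,\nu\}$ for $(Q,B)$. A 2-cocycle is a pair $S=\{S,S_f\}$ of maps $Q^2\to B$ with $S(x,1)=S(1,x)=0$ and $S_f(x,x)=S_f(x,1)=S_f(1,x)=0$.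 It is compatible if the set $B\times Q$ with operations $\langle a,x\rangle\langle b,y\rangle=\langle a+\sigma_x(b)+S(x,y),xy\rangle$ and $\{\langle a,x\rangle,\langle b,y\rangle\}=\langle a+b+\tau_x(b)+S_f(x,y)+\sigma_{\{x,y\}}(\nu_y(a)-a-b),\{x,y\}\rangle$ is a multiplicative Lie algebra. A 2-coboundary is a pair $G,G_f$ for which there is $h:Q\to B$ with $G(x,y)=h(x)+\sigma_x(h(y))-h(xy)$ and $G_f(x,y)=\tau_x(h(y))+h(x)+h(y)+\sigma_{\{x,y\}}(\nu_y(h(x))-h(x)-h(y))-h(\{x,y\})$. Two compatible 2-cocycles are equivalent if their difference is a 2-coboundary; $H^{2}(Q,B,\chi)$ is the group, under pointwise addition, of equivalence classes of compatible 2-cocycles. *)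

theory Defs
  imports "HOL-Algebra.Coset"
begin

section \<open>Multiplicative Lie algebras\<close>

record 'a mult_lie = "'a monoid" +
  bracket :: "'a \<Rightarrow> 'a \<Rightarrow> 'a" ("(\<lbrace>_,_\<rbrace>\<index>)")

definition conjugate :: "('a, 'm) monoid_scheme \<Rightarrow> 'a \<Rightarrow> 'a \<Rightarrow> 'a" where
  "conjugate G x z = z \<otimes>\<^bsub>G\<^esub> x \<otimes>\<^bsub>G\<^esub> inv\<^bsub>G\<^esub> z"

locale multiplicative_lie_algebra = group L
  for L :: "('a, 'm) mult_lie_scheme" (structure) +
  assumes bracket_closed: "\<lbrakk>x \<in> carrier L; y \<in> carrier L\<rbrakk> \<Longrightarrow> \<lbrace>x,y\<rbrace> \<in> carrier L"
    and bracket_self: "x \<in> carrier L \<Longrightarrow> \<lbrace>x,x\<rbrace> = \<one>"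
    and bracket_mult_right: "\<lbrakk>x \<in> carrier L; y \<in> carrier L; z \<in> carrier L\<rbrakk> \<Longrightarrow>
      \<lbrace>x,y \<otimes> z\<rbrace> = \<lbrace>x,y\<rbrace> \<otimes> conjugate L \<lbrace>x,z\<rbrace> y"
    and bracket_mult_left: "\<lbrakk>x \<in> carrier L; y \<in> carrier L; z \<in> carrier L\<rbrakk> \<Longrightarrow>
      \<lbrace>x \<otimes> y,z\<rbrace> = conjugate L \<lbrace>y,z\<rbrace> x \<otimes> \<lbrace>x,z\<rbrace>"
    and bracket_jacobi: "\<lbrakk>x \<in> carrier L; y \<in> carrier L; z \<in> carrier L\<rbrakk> \<Longrightarrow>
      \<lbrace>\<lbrace>x,y\<rbrace>,conjugate L z y\<rbrace> \<otimes> \<lbrace>\<lbrace>y,z\<rbrace>,conjugate L x z\<rbrace> \<otimes> \<lbrace>\<lbrace>z,x\<rbrace>,conjugate L y x\<rbrace> = \<one>"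
    and bracket_conjugate: "\<lbrakk>x \<in> carrier L; y \<in> carrier L; z \<in> carrier L\<rbrakk> \<Longrightarrow>
      conjugate L \<lbrace>x,y\<rbrace> z = \<lbrace>conjugate L x z,conjugate L y z\<rbrace>"

definition mla_hom :: "('a, 'm) mult_lie_scheme \<Rightarrow> ('b, 'n) mult_lie_scheme \<Rightarrow> ('a \<Rightarrow> 'b) set" where
  "mla_hom L M = {f \<in> hom L M. \<forall>x\<in>carrier L. \<forall>y\<in>carrier L. f \<lbrace>x,y\<rbrace>\<^bsub>L\<^esub> = \<lbrace>f x,f y\<rbrace>\<^bsub>M\<^esub>}"

definition mla_iso :: "('a, 'm) mult_lie_scheme \<Rightarrow> ('b, 'n) mult_lie_scheme \<Rightarrow> ('a \<Rightarrow> 'b) set" where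
  "mla_iso L M = {f \<in> mla_hom L M. bij_betw f (carrier L) (carrier M)}"

definition alg_center :: "('a, 'm) mult_lie_scheme \<Rightarrow> 'a set" where
  "alg_center I = {a \<in> carrier I. \<forall>b\<in>carrier I.
     a \<otimes>\<^bsub>I\<^esub> b = b \<otimes>\<^bsub>I\<^esub> a \<and> \<lbrace>a,b\<rbrace>\<^bsub>I\<^esub> = \<one>\<^bsub>I\<^esub> \<and> \<lbrace>b,a\<rbrace>\<^bsub>I\<^esub> = \<one>\<^bsub>I\<^esub>}"

definition center_algebra :: "('a, 'm) mult_lie_scheme \<Rightarrow> ('a, 'm) mult_lie_scheme" where
  "center_algebra I = I\<lparr>carrier := alg_center I\<rparr>"


section \<open>Action terms\<close>

text \<open>The index in $Q$ comes first for all three components: \<open>nu \<chi> x a\<close> is $\nu_x(a)$.\<close>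

record ('q, 'i) action_terms =
  sigma :: "'q \<Rightarrow> 'i \<Rightarrow> 'i"
  tau :: "'q \<Rightarrow> 'i \<Rightarrow> 'i"
  nu :: "'q \<Rightarrow> 'i \<Rightarrow> 'i"

definition is_action_terms ::
  "('q, 'm) mult_lie_scheme \<Rightarrow> ('i, 'n) mult_lie_scheme \<Rightarrow> ('q, 'i) action_terms \<Rightarrow> bool" where
  "is_action_terms Q I \<chi> \<longleftrightarrow> (\<forall>x\<in>carrier Q.
     sigma \<chi> x \<in> mla_iso I I \<and>
     tau \<chi> x \<in> carrier I \<rightarrow> carrier I \<and> tau \<chi> x \<one>\<^bsub>I\<^esub> = \<one>\<^bsub>I\<^esub> \<and>
     nu \<chi> x \<in> carrier I \<rightarrow> carrier I \<and> nu \<chi> x \<one>\<^bsub>I\<^esub> = \<one>\<^bsub>I\<^esub>)"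

text \<open>Equality of action terms as functions on the carriers; values elsewhere are irrelevant.\<close>

definition same_terms ::
  "('q, 'm) mult_lie_scheme \<Rightarrow> ('i, 'n) mult_lie_scheme \<Rightarrow>
   ('q, 'i) action_terms \<Rightarrow> ('q, 'i) action_terms \<Rightarrow> bool" where
  "same_terms Q I \<chi> \<chi>' \<longleftrightarrow> (\<forall>x\<in>carrier Q. \<forall>a\<in>carrier I.
     sigma \<chi> x a = sigma \<chi>' x a \<and> tau \<chi> x a = tau \<chi>' x a \<and> nu \<chi> x a = nu \<chi>' x a)"

definition equiv_terms ::
  "('q, 'm) mult_lie_scheme \<Rightarrow> ('i, 'n) mult_lie_scheme \<Rightarrow>
   ('q, 'i) action_terms \<Rightarrow> ('q, 'i) action_terms \<Rightarrow> bool" where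
  "equiv_terms Q I \<chi> \<chi>' \<longleftrightarrow> (\<exists>h \<in> carrier Q \<rightarrow> carrier I. \<forall>x\<in>carrier Q. \<forall>a\<in>carrier I.
     sigma \<chi> x a = h x \<otimes>\<^bsub>I\<^esub> sigma \<chi>' x a \<otimes>\<^bsub>I\<^esub> inv\<^bsub>I\<^esub> (h x) \<and>
     tau \<chi> x a = conjugate I (tau \<chi>' x a) (h x) \<otimes>\<^bsub>I\<^esub> \<lbrace>h x,a\<rbrace>\<^bsub>I\<^esub> \<and>
     nu \<chi> x a = \<lbrace>a,h x\<rbrace>\<^bsub>I\<^esub> \<otimes>\<^bsub>I\<^esub> conjugate I (nu \<chi>' x a) (h x))"

definition restrict_terms :: "('q, 'i) action_terms \<Rightarrow> 'i set \<Rightarrow> ('q, 'i) action_terms" where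
  "restrict_terms \<chi> B = \<lparr>sigma = (\<lambda>x. restrict (sigma \<chi> x) B),
     tau = (\<lambda>x. restrict (tau \<chi> x) B), nu = (\<lambda>x. restrict (nu \<chi> x) B)\<rparr>"


section \<open>Extensions\<close>

record ('i, 'e, 'q) extension =
  total :: "'e mult_lie"
  incl :: "'i \<Rightarrow> 'e"
  proj :: "'e \<Rightarrow> 'q"

definition is_extension ::
  "('q, 'm) mult_lie_scheme \<Rightarrow> ('i, 'n) mult_lie_scheme \<Rightarrow> ('i, 'e, 'q) extension \<Rightarrow> bool" where
  "is_extension Q I E \<longleftrightarrow>
     multiplicative_lie_algebra (total E) \<and>
     incl E \<in> mla_hom I (total E) \<and> inj_on (incl E) (carrier I) \<and>
     proj E \<in> mla_hom (total E) Q \<and> proj E ` carrier (total E) = carrier Q \<and>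
     incl E ` carrier I = kernel (total E) Q (proj E)"

definition is_section ::
  "('q, 'm) mult_lie_scheme \<Rightarrow> ('i, 'e, 'q) extension \<Rightarrow> ('q \<Rightarrow> 'e) \<Rightarrow> bool" where
  "is_section Q E l \<longleftrightarrow> l \<in> carrier Q \<rightarrow> carrier (total E) \<and>
     (\<forall>x\<in>carrier Q. proj E (l x) = x) \<and> l \<one>\<^bsub>Q\<^esub> = \<one>\<^bsub>total E\<^esub>"

text \<open>The inverse of the inclusion carries out the identification of $I$ with its image.\<close>

definition section_terms ::
  "('i, 'n) mult_lie_scheme \<Rightarrow> ('i, 'e, 'q) extension \<Rightarrow> ('q \<Rightarrow> 'e) \<Rightarrow> ('q, 'i) action_terms" where
  "section_terms I E l =
     (let A = total E; i = incl E; j = inv_into (carrier I) i in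
      \<lparr>sigma = (\<lambda>x a. j (l x \<otimes>\<^bsub>A\<^esub> i a \<otimes>\<^bsub>A\<^esub> inv\<^bsub>A\<^esub> (l x))),
       tau = (\<lambda>x a. j \<lbrace>l x,i a\<rbrace>\<^bsub>A\<^esub>),
       nu = (\<lambda>x a. j \<lbrace>i a,l x\<rbrace>\<^bsub>A\<^esub>)\<rparr>)"

definition realizes_terms ::
  "('q, 'm) mult_lie_scheme \<Rightarrow> ('i, 'n) mult_lie_scheme \<Rightarrow> ('q, 'i) action_terms \<Rightarrow>
   ('i, 'e, 'q) extension \<Rightarrow> bool" where
  "realizes_terms Q I \<chi> E \<longleftrightarrow> (\<exists>l. is_section Q E l \<and> same_terms Q I \<chi> (section_terms I E l))"

definition realizes_class ::
  "('q, 'm) mult_lie_scheme \<Rightarrow> ('i, 'n) mult_lie_scheme \<Rightarrow> ('q, 'i) action_terms \<Rightarrow>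
   ('i, 'e, 'q) extension \<Rightarrow> bool" where
  "realizes_class Q I \<chi> E \<longleftrightarrow> (\<exists>l. is_section Q E l \<and> equiv_terms Q I (section_terms I E l) \<chi>)"

definition ext_rel ::
  "('q, 'm) mult_lie_scheme \<Rightarrow> ('i, 'n) mult_lie_scheme \<Rightarrow> ('i, 'e, 'q) extension rel" where
  "ext_rel Q I = {(E, E'). is_extension Q I E \<and> is_extension Q I E' \<and>
     (\<exists>\<phi> \<in> mla_iso (total E) (total E').
        (\<forall>a\<in>carrier I. \<phi> (incl E a) = incl E' a) \<and>
        (\<forall>p\<in>carrier (total E). proj E' (\<phi> p) = proj E p))}"

text \<open>
  The underlying sets of the extensions range over the subsets of a type \<open>'e\<close>, since a set of
  classes of all extensions, of whatever type, cannot be formed. Every extension of $I$ by $Q$ is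
  equipotent with $I \times Q$, so as soon as \<open>'e\<close> carries one extension, every
  extension over any type is equivalent to one over \<open>'e\<close>.
\<close>

definition Ext ::
  "('q, 'm) mult_lie_scheme \<Rightarrow> ('i, 'n) mult_lie_scheme \<Rightarrow> ('q, 'i) action_terms \<Rightarrow>
   ('i, 'e, 'q) extension set set" where
  "Ext Q I \<chi> = {E. is_extension Q I E \<and> realizes_class Q I \<chi> E} // ext_rel Q I"


section \<open>Abelian second cohomology\<close>

text \<open>
  The coefficient algebra $B$ is written multiplicatively here, so that $a + b$ and $a - b$ become
  \<open>a \<otimes>\<^bsub>B\<^esub> b\<close> and \<open>a \<otimes>\<^bsub>B\<^esub> inv\<^bsub>B\<^esub> b\<close>. The definitions are meant for
  commutative $B$ with trivial bracket.
\<close>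

type_synonym ('q, 'b) cochain = "('q \<Rightarrow> 'q \<Rightarrow> 'b) \<times> ('q \<Rightarrow> 'q \<Rightarrow> 'b)"

definition two_cocycle ::
  "('q, 'm) mult_lie_scheme \<Rightarrow> ('b, 'n) mult_lie_scheme \<Rightarrow> ('q, 'b) cochain \<Rightarrow> bool" where
  "two_cocycle Q B = (\<lambda>(S, Sf).
     (\<forall>x\<in>carrier Q. \<forall>y\<in>carrier Q. S x y \<in> carrier B \<and> Sf x y \<in> carrier B) \<and>
     (\<forall>x\<in>carrier Q. S x \<one>\<^bsub>Q\<^esub> = \<one>\<^bsub>B\<^esub> \<and> S \<one>\<^bsub>Q\<^esub> x = \<one>\<^bsub>B\<^esub> \<and>
        Sf x x = \<one>\<^bsub>B\<^esub> \<and> Sf x \<one>\<^bsub>Q\<^esub> = \<one>\<^bsub>B\<^esub> \<and> Sf \<one>\<^bsub>Q\<^esub> x = \<one>\<^bsub>B\<^esub>))"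

text \<open>
  If the product below is a group operation on $B \times Q$, then $\langle 0, 1\rangle$, being
  idempotent by the normalization of $S$, is its identity element.
\<close>

definition cocycle_algebra ::
  "('q, 'm) mult_lie_scheme \<Rightarrow> ('b, 'n) mult_lie_scheme \<Rightarrow> ('q, 'b) action_terms \<Rightarrow>
   ('q, 'b) cochain \<Rightarrow> ('b \<times> 'q) mult_lie" where
  "cocycle_algebra Q B \<chi> = (\<lambda>(S, Sf).
     \<lparr>carrier = carrier B \<times> carrier Q,
      mult = (\<lambda>(a, x) (b, y). (a \<otimes>\<^bsub>B\<^esub> sigma \<chi> x b \<otimes>\<^bsub>B\<^esub> S x y, x \<otimes>\<^bsub>Q\<^esub> y)),
      one = (\<one>\<^bsub>B\<^esub>, \<one>\<^bsub>Q\<^esub>),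
      bracket = (\<lambda>(a, x) (b, y).
        (a \<otimes>\<^bsub>B\<^esub> b \<otimes>\<^bsub>B\<^esub> tau \<chi> x b \<otimes>\<^bsub>B\<^esub> Sf x y \<otimes>\<^bsub>B\<^esub>
           sigma \<chi> \<lbrace>x,y\<rbrace>\<^bsub>Q\<^esub> (nu \<chi> y a \<otimes>\<^bsub>B\<^esub> inv\<^bsub>B\<^esub> a \<otimes>\<^bsub>B\<^esub> inv\<^bsub>B\<^esub> b),
         \<lbrace>x,y\<rbrace>\<^bsub>Q\<^esub>))\<rparr>)"

definition compatible_cocycles ::
  "('q, 'm) mult_lie_scheme \<Rightarrow> ('b, 'n) mult_lie_scheme \<Rightarrow> ('q, 'b) action_terms \<Rightarrow>
   ('q, 'b) cochain set" where
  "compatible_cocycles Q B \<chi> =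
     {S. two_cocycle Q B S \<and> multiplicative_lie_algebra (cocycle_algebra Q B \<chi> S)}"

definition two_coboundary ::
  "('q, 'm) mult_lie_scheme \<Rightarrow> ('b, 'n) mult_lie_scheme \<Rightarrow> ('q, 'b) action_terms \<Rightarrow>
   ('q, 'b) cochain \<Rightarrow> bool" where
  "two_coboundary Q B \<chi> = (\<lambda>(G, Gf). \<exists>h \<in> carrier Q \<rightarrow> carrier B.
     \<forall>x\<in>carrier Q. \<forall>y\<in>carrier Q.
       G x y = h x \<otimes>\<^bsub>B\<^esub> sigma \<chi> x (h y) \<otimes>\<^bsub>B\<^esub> inv\<^bsub>B\<^esub> (h (x \<otimes>\<^bsub>Q\<^esub> y)) \<and>
       Gf x y = tau \<chi> x (h y) \<otimes>\<^bsub>B\<^esub> h x \<otimes>\<^bsub>B\<^esub> h y \<otimes>\<^bsub>B\<^esub>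
         sigma \<chi> \<lbrace>x,y\<rbrace>\<^bsub>Q\<^esub> (nu \<chi> y (h x) \<otimes>\<^bsub>B\<^esub> inv\<^bsub>B\<^esub> (h x) \<otimes>\<^bsub>B\<^esub> inv\<^bsub>B\<^esub> (h y)) \<otimes>\<^bsub>B\<^esub>
         inv\<^bsub>B\<^esub> (h \<lbrace>x,y\<rbrace>\<^bsub>Q\<^esub>))"

definition cochain_add ::
  "('b, 'n) mult_lie_scheme \<Rightarrow> ('q, 'b) cochain \<Rightarrow> ('q, 'b) cochain \<Rightarrow> ('q, 'b) cochain" where
  "cochain_add B = (\<lambda>(S, Sf) (T, Tf).
     (\<lambda>x y. S x y \<otimes>\<^bsub>B\<^esub> T x y, \<lambda>x y. Sf x y \<otimes>\<^bsub>B\<^esub> Tf x y))"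

definition cochain_diff ::
  "('b, 'n) mult_lie_scheme \<Rightarrow> ('q, 'b) cochain \<Rightarrow> ('q, 'b) cochain \<Rightarrow> ('q, 'b) cochain" where
  "cochain_diff B = (\<lambda>(S, Sf) (T, Tf).
     (\<lambda>x y. S x y \<otimes>\<^bsub>B\<^esub> inv\<^bsub>B\<^esub> (T x y), \<lambda>x y. Sf x y \<otimes>\<^bsub>B\<^esub> inv\<^bsub>B\<^esub> (Tf x y)))"

definition cohomologous ::
  "('q, 'm) mult_lie_scheme \<Rightarrow> ('b, 'n) mult_lie_scheme \<Rightarrow> ('q, 'b) action_terms \<Rightarrow>
   ('q, 'b) cochain rel" where
  "cohomologous Q B \<chi> = {(S, T). S \<in> compatible_cocycles Q B \<chi> \<and> T \<in> compatible_cocycles Q B \<chi> \<and>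
     two_coboundary Q B \<chi> (cochain_diff B S T)}"

text \<open>
  Cocycles are not required to be extensional, but the classes do not see values outside the
  carrier of $Q$.
\<close>

definition H2 ::
  "('q, 'm) mult_lie_scheme \<Rightarrow> ('b, 'n) mult_lie_scheme \<Rightarrow> ('q, 'b) action_terms \<Rightarrow>
   ('q, 'b) cochain set monoid" where
  "H2 Q B \<chi> =
     \<lparr>carrier = compatible_cocycles Q B \<chi> // cohomologous Q B \<chi>,
      mult = (\<lambda>X Y. \<Union>S\<in>X. \<Union>T\<in>Y. cohomologous Q B \<chi> `` {cochain_add B S T}),
      one = cohomologous Q B \<chi> `` {(\<lambda>_ _. \<one>\<^bsub>B\<^esub>, \<lambda>_ _. \<one>\<^bsub>B\<^esub>)}\<rparr>"

end

theory Submission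
  imports Defs
begin

text \<open>
  Fix an extension \<open>A\<close> of \<open>I\<close> by \<open>Q\<close> with a section \<open>l\<close> realizing \<open>\<chi>\<close>, and write \<open>Z\<close> for the algebraic
  center of \<open>I\<close>. A compatible cocycle \<open>(S, S\<^sub>f)\<close> with values in \<open>Z\<close> twists \<open>A\<close>: on the same carrier
  one takes \<open>S(x,y) p q\<close> as the new product and \<open>S\<^sub>f(x,y) {p,q}\<close> as the new bracket of \<open>p\<close> over \<open>x\<close> and
  \<open>q\<close> over \<open>y\<close>. The bijection sends the class of a cocycle to the class of the twisted extension.

  No axiom of the twisted algebra is verified by computation. All axioms are equations, so they pass
  to products, subalgebras and images (\<open>image_mla\<close>); the twisted algebra is an image of the
  fibre product of \<open>A\<close> with the cocycle algebra (\<open>twist_mla\<close>), and the cocycle algebra is an image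
  of a subalgebra of the product of the twisted algebra with \<open>A\<close> (\<open>cocycle_of_twist_mla\<close>). So a
  normalized cochain is compatible exactly when its twist is a multiplicative Lie algebra. Both maps
  are homomorphisms because the product and bracket of \<open>w p\<close> and \<open>v q\<close>, for central \<open>w\<close>, \<open>v\<close>, differ from
  those of \<open>p\<close> and \<open>q\<close> by precisely the factors in the definition of the cocycle algebra
  (\<open>mult_Z_mult\<close>, \<open>bracket_Z_mult\<close>).

  An equivalence between two twists moves each \<open>p\<close> to an element of the same fibre with the same
  action on \<open>I\<close>, hence multiplies it by a central \<open>h(\<pi>(p))\<close>; being a homomorphism then says that \<open>h\<close>
  cobounds the difference of the cocycles (\<open>cohomologous_iff\<close>).

  The harder half is that every extension \<open>A'\<close> with a section \<open>l'\<close> realizing \<open>\<chi>\<close> is equivalent to a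
  twist of \<open>A\<close>. The bijection \<open>u l(x) \<mapsto> u l'(x)\<close> is to be compared with a homomorphism, and the defects
  \<open>l'(x) l'(y)\<close> and \<open>{l'(x),l'(y)}\<close> have to be shown central relative to the images of \<open>l(x) l(y)\<close> and
  \<open>{l(x),l(y)}\<close>. Equality of action terms says that the pairs \<open>(l(x), l'(x))\<close> in \<open>A \<times> A'\<close> conjugate and bracket
  the diagonal copy of \<open>I\<close> into itself, that is, lie in its idealizer. The key fact is that the
  idealizer of a subalgebra is again a subalgebra (\<open>idealizer_mult\<close>, \<open>idealizer_bracket\<close>), so it contains the pairs
  of products and of brackets as well. Two partners in one fibre of the same element act alike on \<open>I\<close>
  and therefore differ by an element of \<open>Z\<close> (\<open>alike_differ_by_Z\<close>).

  An extension that realizes only the class of \<open>\<chi>\<close> has another section that realizes \<open>\<chi>\<close> itself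
  (\<open>realization_equiv_terms\<close>).
\<close>


section \<open>Bracket calculus\<close>

context group
begin

lemma cancel_inv_left: "\<lbrakk>x \<in> carrier G; y \<in> carrier G\<rbrakk> \<Longrightarrow> inv x \<otimes> (x \<otimes> y) = y"
  by (simp add: m_assoc [symmetric])

lemma cancel_inv_right: "\<lbrakk>x \<in> carrier G; y \<in> carrier G\<rbrakk> \<Longrightarrow> x \<otimes> (inv x \<otimes> y) = y"
  by (simp add: m_assoc [symmetric])

lemmas word_simps = m_assoc inv_mult_group cancel_inv_left cancel_inv_right

lemma conjugate_closed [simp]:
  "\<lbrakk>x \<in> carrier G; z \<in> carrier G\<rbrakk> \<Longrightarrow> conjugate G x z \<in> carrier G"
  by (simp add: conjugate_def)

lemma conjugate_mult:
  "\<lbrakk>x \<in> carrier G; y \<in> carrier G; z \<in> carrier G\<rbrakk> \<Longrightarrow>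
    conjugate G (x \<otimes> y) z = conjugate G x z \<otimes> conjugate G y z"
  by (simp add: conjugate_def word_simps)

lemma conjugate_by_mult:
  "\<lbrakk>x \<in> carrier G; y \<in> carrier G; z \<in> carrier G\<rbrakk> \<Longrightarrow>
    conjugate G x (y \<otimes> z) = conjugate G (conjugate G x z) y"
  by (simp add: conjugate_def word_simps)

lemma conjugate_inv:
  "\<lbrakk>x \<in> carrier G; z \<in> carrier G\<rbrakk> \<Longrightarrow> conjugate G (inv x) z = inv (conjugate G x z)"
  by (simp add: conjugate_def word_simps)

lemma conjugate_one [simp]: "z \<in> carrier G \<Longrightarrow> conjugate G \<one> z = \<one>"
  by (simp add: conjugate_def)

lemma conjugate_by_one [simp]: "x \<in> carrier G \<Longrightarrow> conjugate G x \<one> = x"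
  by (simp add: conjugate_def)

lemma conjugate_inv_cancel [simp]:
  "\<lbrakk>x \<in> carrier G; z \<in> carrier G\<rbrakk> \<Longrightarrow> conjugate G (conjugate G x (inv z)) z = x"
  by (simp add: conjugate_def word_simps)

lemma conjugate_commute:
  "\<lbrakk>x \<in> carrier G; z \<in> carrier G; z \<otimes> x = x \<otimes> z\<rbrakk> \<Longrightarrow> conjugate G x z = x"
  by (simp add: conjugate_def m_assoc)

lemma conjugateI:
  "\<lbrakk>x \<in> carrier G; y \<in> carrier G; z \<in> carrier G; z \<otimes> x = y \<otimes> z\<rbrakk> \<Longrightarrow> conjugate G x z = y"
  by (simp add: conjugate_def m_assoc)

lemma idempotent_is_one: "\<lbrakk>x \<in> carrier G; x \<otimes> x = x\<rbrakk> \<Longrightarrow> x = \<one>"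
  using l_cancel_one by blast

end

context multiplicative_lie_algebra
begin

declare bracket_closed [simp] bracket_self [simp]

lemma bracket_one_right [simp]: "x \<in> carrier L \<Longrightarrow> \<lbrace>x,\<one>\<rbrace> = \<one>"
  by (rule idempotent_is_one) (use bracket_mult_right [of x \<one> \<one>] in simp_all)

lemma bracket_one_left [simp]: "x \<in> carrier L \<Longrightarrow> \<lbrace>\<one>,x\<rbrace> = \<one>"
  by (rule idempotent_is_one) (use bracket_mult_left [of \<one> \<one> x] in simp_all)

lemma bracket_antisym:
  assumes "x \<in> carrier L" "y \<in> carrier L"
  shows "inv \<lbrace>x,y\<rbrace> = \<lbrace>y,x\<rbrace>"
proof -
  have "\<one> = \<lbrace>x \<otimes> y, x \<otimes> y\<rbrace>" using assms by simp
  also have "\<dots> = conjugate L (\<lbrace>y,x\<rbrace> \<otimes> \<lbrace>x,y\<rbrace>) x"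
    using assms by (simp add: bracket_mult_left bracket_mult_right conjugate_mult del: bracket_self)
       (simp add: bracket_self conjugate_mult)
  finally have *: "conjugate L (\<lbrace>y,x\<rbrace> \<otimes> \<lbrace>x,y\<rbrace>) x = \<one>" by simp
  have "\<lbrace>y,x\<rbrace> \<otimes> \<lbrace>x,y\<rbrace> = conjugate L (conjugate L (\<lbrace>y,x\<rbrace> \<otimes> \<lbrace>x,y\<rbrace>) x) (inv x)"
    using assms by (simp add: conjugate_def word_simps)
  also have "\<dots> = \<one>" using assms by (simp add: *)
  finally show ?thesis using assms by (intro inv_equality) auto
qed

lemma bracket_inv_left:
  assumes "x \<in> carrier L" "y \<in> carrier L"
  shows "\<lbrace>inv x,y\<rbrace> = conjugate L (inv \<lbrace>x,y\<rbrace>) (inv x)"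
proof -
  have "\<lbrace>inv x \<otimes> x,y\<rbrace> = \<one>" using assms by simp
  then have "conjugate L \<lbrace>x,y\<rbrace> (inv x) \<otimes> \<lbrace>inv x,y\<rbrace> = \<one>"
    using bracket_mult_left [of "inv x" x y] assms by simp
  then have "\<lbrace>inv x,y\<rbrace> = inv (conjugate L \<lbrace>x,y\<rbrace> (inv x))"
    using assms by (metis bracket_closed conjugate_closed inv_closed inv_equality inv_inv)
  then show ?thesis using assms by (simp add: conjugate_inv)
qed

lemma bracket_mult_mult:
  assumes "a \<in> carrier L" "b \<in> carrier L" "x \<in> carrier L" "y \<in> carrier L"
  shows "\<lbrace>a \<otimes> x,b \<otimes> y\<rbrace> =
    conjugate L \<lbrace>x,b\<rbrace> a \<otimes> conjugate L \<lbrace>x,y\<rbrace> (a \<otimes> b) \<otimes> \<lbrace>a,b\<rbrace> \<otimes> conjugate L \<lbrace>a,y\<rbrace> b"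
proof -
  have "\<lbrace>a \<otimes> x,b \<otimes> y\<rbrace> = conjugate L \<lbrace>x,b \<otimes> y\<rbrace> a \<otimes> \<lbrace>a,b \<otimes> y\<rbrace>"
    using assms by (intro bracket_mult_left) auto
  then show ?thesis
    using assms by (simp add: bracket_mult_right conjugate_mult conjugate_by_mult m_assoc)
qed

text \<open>
  Expanding a bracket of two products in both orders shows that \<open>{a,b}\<close> and the group commutator
  of \<open>a\<close> and \<open>b\<close> act alike on brackets.
\<close>

lemma conjugate_bracket_by_bracket:
  assumes "a \<in> carrier L" "b \<in> carrier L" "x \<in> carrier L" "y \<in> carrier L"
  shows "conjugate L \<lbrace>x,y\<rbrace> \<lbrace>a,b\<rbrace> = conjugate L \<lbrace>x,y\<rbrace> (a \<otimes> b \<otimes> inv (b \<otimes> a))"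
proof -
  define x' where "x' = conjugate L x (inv (b \<otimes> a))"
  define y' where "y' = conjugate L y (inv (b \<otimes> a))"
  have c: "x' \<in> carrier L" "y' \<in> carrier L" using assms by (auto simp: x'_def y'_def)
  have "conjugate L \<lbrace>x',b\<rbrace> a \<otimes> conjugate L \<lbrace>x',y'\<rbrace> (a \<otimes> b) \<otimes> \<lbrace>a,b\<rbrace> \<otimes> conjugate L \<lbrace>a,y'\<rbrace> b
      = conjugate L \<lbrace>x',b\<rbrace> a \<otimes> \<lbrace>a,b\<rbrace> \<otimes> conjugate L \<lbrace>x',y'\<rbrace> (b \<otimes> a) \<otimes> conjugate L \<lbrace>a,y'\<rbrace> b"
  proof -
    have "\<lbrace>a \<otimes> x',b \<otimes> y'\<rbrace> = \<lbrace>a \<otimes> x',b\<rbrace> \<otimes> conjugate L \<lbrace>a \<otimes> x',y'\<rbrace> b"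
      using assms c by (intro bracket_mult_right) auto
    then show ?thesis
      using assms c bracket_mult_mult [of a b x' y']
      by (simp add: bracket_mult_left conjugate_mult conjugate_by_mult m_assoc)
  qed
  then have *: "conjugate L \<lbrace>x',y'\<rbrace> (a \<otimes> b) \<otimes> \<lbrace>a,b\<rbrace> = \<lbrace>a,b\<rbrace> \<otimes> conjugate L \<lbrace>x',y'\<rbrace> (b \<otimes> a)"
    using assms c by (simp add: m_assoc) (simp add: m_assoc [symmetric])
  have w: "\<lbrace>x',y'\<rbrace> = conjugate L \<lbrace>x,y\<rbrace> (inv (b \<otimes> a))"
    using assms by (simp add: x'_def y'_def bracket_conjugate)
  have 1: "conjugate L \<lbrace>x',y'\<rbrace> (b \<otimes> a) = \<lbrace>x,y\<rbrace>"
    unfolding w using assms by (simp add: conjugate_inv_cancel del: inv_mult_group)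
  have 2: "conjugate L \<lbrace>x',y'\<rbrace> (a \<otimes> b) = conjugate L \<lbrace>x,y\<rbrace> (a \<otimes> b \<otimes> inv (b \<otimes> a))"
    unfolding w using assms by (simp add: conjugate_by_mult [symmetric])
  have "\<lbrace>a,b\<rbrace> \<otimes> \<lbrace>x,y\<rbrace> \<otimes> inv \<lbrace>a,b\<rbrace> =
      conjugate L \<lbrace>x,y\<rbrace> (a \<otimes> b \<otimes> inv (b \<otimes> a)) \<otimes> \<lbrace>a,b\<rbrace> \<otimes> inv \<lbrace>a,b\<rbrace>"
    using * unfolding 1 2 by simp
  then show ?thesis using assms by (simp add: conjugate_def [of _ _ "\<lbrace>a,b\<rbrace>"] m_assoc)
qed

end

section \<open>Subalgebras and the idealizer\<close>

definition mla_subalgebra :: "'a set \<Rightarrow> ('a, 'm) mult_lie_scheme \<Rightarrow> bool" where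
  "mla_subalgebra H L \<longleftrightarrow> subgroup H L \<and> (\<forall>x\<in>H. \<forall>y\<in>H. \<lbrace>x,y\<rbrace>\<^bsub>L\<^esub> \<in> H)"

text \<open>Both \<open>g\<close> and its inverse have to conjugate \<open>H\<close> into itself, as \<open>H\<close> may be infinite.\<close>

definition idealizer :: "('a, 'm) mult_lie_scheme \<Rightarrow> 'a set \<Rightarrow> 'a set" where
  "idealizer L H = {g \<in> carrier L. \<forall>h\<in>H.
     conjugate L h g \<in> H \<and> conjugate L h (inv\<^bsub>L\<^esub> g) \<in> H \<and> \<lbrace>g,h\<rbrace>\<^bsub>L\<^esub> \<in> H}"

lemma idealizerD:
  assumes "g \<in> idealizer L H"
  shows "g \<in> carrier L"
    and "h \<in> H \<Longrightarrow> conjugate L h g \<in> H"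
    and "h \<in> H \<Longrightarrow> conjugate L h (inv\<^bsub>L\<^esub> g) \<in> H"
    and "h \<in> H \<Longrightarrow> \<lbrace>g,h\<rbrace>\<^bsub>L\<^esub> \<in> H"
  using assms by (simp_all add: idealizer_def)

lemma idealizerI:
  assumes "g \<in> carrier L"
    and "\<And>h. h \<in> H \<Longrightarrow> conjugate L h g \<in> H"
    and "\<And>h. h \<in> H \<Longrightarrow> conjugate L h (inv\<^bsub>L\<^esub> g) \<in> H"
    and "\<And>h. h \<in> H \<Longrightarrow> \<lbrace>g,h\<rbrace>\<^bsub>L\<^esub> \<in> H"
  shows "g \<in> idealizer L H"
  using assms by (simp add: idealizer_def)

context multiplicative_lie_algebra
begin

lemma subalgebra_mla:
  assumes "mla_subalgebra H L"
  shows "multiplicative_lie_algebra (L\<lparr>carrier := H\<rparr>)"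
proof -
  interpret H: subgroup H L using assms by (simp add: mla_subalgebra_def)
  interpret G: group "L\<lparr>carrier := H\<rparr>" by (rule H.subgroup_is_group) (rule is_group)
  have inv: "inv\<^bsub>L\<lparr>carrier := H\<rparr>\<^esub> x = inv x" if "x \<in> H" for x
    using m_inv_consistent [OF H.subgroup_axioms that] .
  have conj: "conjugate (L\<lparr>carrier := H\<rparr>) x z = conjugate L x z" if "z \<in> H" for x z
    using that by (simp add: conjugate_def inv)
  show ?thesis
    using assms
    by unfold_locales
      (simp_all add: mla_subalgebra_def conj bracket_mult_right bracket_mult_left bracket_jacobi
         bracket_conjugate)
qed

lemma subalgebra_subset_idealizer:
  assumes "mla_subalgebra H L"
  shows "H \<subseteq> idealizer L H"
proof -
  interpret H: subgroup H L using assms by (simp add: mla_subalgebra_def)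
  show ?thesis
    using assms by (auto simp: idealizer_def mla_subalgebra_def conjugate_def)
qed

lemma idealizer_mult:
  assumes "mla_subalgebra H L" "g \<in> idealizer L H" "k \<in> idealizer L H"
  shows "g \<otimes> k \<in> idealizer L H"
proof -
  interpret H: subgroup H L using assms(1) by (simp add: mla_subalgebra_def)
  note [simp] = idealizerD [OF assms(2)] idealizerD [OF assms(3)]
  show ?thesis
    by (rule idealizerI) (simp_all add: inv_mult_group conjugate_by_mult bracket_mult_left)
qed

lemma idealizer_inv:
  assumes "mla_subalgebra H L" "g \<in> idealizer L H"
  shows "inv g \<in> idealizer L H"
proof -
  interpret H: subgroup H L using assms(1) by (simp add: mla_subalgebra_def)
  note [simp] = idealizerD [OF assms(2)]
  show ?thesis
    by (rule idealizerI) (simp_all add: bracket_inv_left conjugate_inv)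
qed

lemma idealizer_subgroup:
  assumes "mla_subalgebra H L"
  shows "subgroup (idealizer L H) L"
proof
  show "idealizer L H \<subseteq> carrier L" by (auto simp: idealizer_def)
  show "\<one> \<in> idealizer L H"
    using subalgebra_subset_idealizer [OF assms] assms
    by (auto simp: mla_subalgebra_def subgroup_def)
qed (simp_all add: assms idealizer_mult idealizer_inv)

text \<open>
  For the normalizing part, \<open>k c = e k\<close> with \<open>e = k c k\<inverse>\<close> gives two expansions of \<open>{g, k c}\<close>.
  Comparing them shows that conjugation by \<open>{g,k}\<close> maps \<open>{g,c}\<^sup>k e\<close> to \<open>{g,e} e\<close>. The factor
  \<open>{g,c}\<^sup>k\<close> is itself a bracket, on which \<open>{g,k}\<close> acts like a commutator, so \<open>e\<close> stays in \<open>H\<close> too.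
\<close>

lemma idealizer_bracket_normalizes:
  assumes H: "mla_subalgebra H L" and g: "g \<in> idealizer L H" and k: "k \<in> idealizer L H"
    and e: "e \<in> H"
  shows "conjugate L e \<lbrace>g,k\<rbrace> \<in> H"
proof -
  interpret H: subgroup H L using H by (simp add: mla_subalgebra_def)
  interpret N: subgroup "idealizer L H" L by (rule idealizer_subgroup [OF H])
  have gk [simp]: "g \<in> carrier L" "k \<in> carrier L" "e \<in> carrier L"
    using g k e by (auto dest: idealizerD(1))
  define c where "c = conjugate L e (inv k)"
  have c: "c \<in> H" "c \<in> carrier L" using idealizerD(3) [OF k e] by (auto simp: c_def)
  define m where "m = conjugate L \<lbrace>g,c\<rbrace> k"
  have m: "m \<in> H" "m \<in> carrier L" 
    using idealizerD(2) [OF k idealizerD(4) [OF g c(1)]] by (auto simp: m_def)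
  have ge: "\<lbrace>g,e\<rbrace> \<in> H" using idealizerD(4) [OF g e] .
  have "k \<otimes> c = e \<otimes> k" by (simp add: c_def conjugate_def word_simps)
  then have "\<lbrace>g,k\<rbrace> \<otimes> m = \<lbrace>g,e\<rbrace> \<otimes> conjugate L \<lbrace>g,k\<rbrace> e"
    using bracket_mult_right [of g k c] bracket_mult_right [of g e k] c by (simp add: m_def)
  then have "\<lbrace>g,k\<rbrace> \<otimes> m \<otimes> (e \<otimes> inv \<lbrace>g,k\<rbrace>) = \<lbrace>g,e\<rbrace> \<otimes> conjugate L \<lbrace>g,k\<rbrace> e \<otimes> (e \<otimes> inv \<lbrace>g,k\<rbrace>)"
    by simp
  then have 1: "conjugate L m \<lbrace>g,k\<rbrace> \<otimes> conjugate L e \<lbrace>g,k\<rbrace> = \<lbrace>g,e\<rbrace> \<otimes> e"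
    using c m by (simp add: conjugate_def word_simps)
  have mb: "m = \<lbrace>conjugate L g k, conjugate L c k\<rbrace>"
    using c by (simp add: m_def bracket_conjugate)
  have "conjugate L m \<lbrace>g,k\<rbrace> = conjugate L m (g \<otimes> k \<otimes> inv (k \<otimes> g))"
    unfolding mb using c by (intro conjugate_bracket_by_bracket) auto
  moreover have "g \<otimes> k \<otimes> inv (k \<otimes> g) \<in> idealizer L H" using g k by blast
  ultimately have 2: "conjugate L m \<lbrace>g,k\<rbrace> \<in> H" using m by (simp add: idealizerD(2))
  have "conjugate L e \<lbrace>g,k\<rbrace> = inv (conjugate L m \<lbrace>g,k\<rbrace>) \<otimes> (\<lbrace>g,e\<rbrace> \<otimes> e)"
    unfolding 1 [symmetric] using m by (simp add: cancel_inv_left)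
  then show ?thesis using 2 ge e by simp
qed

text \<open>
  The Jacobi identity for \<open>g\<close>, \<open>k\<close> and a conjugate of \<open>h\<close> expresses \<open>{{g,k},h}\<close> by brackets of
  elements of \<open>H\<close> with elements of the idealizer.
\<close>

lemma idealizer_bracket:
  assumes H: "mla_subalgebra H L" and g: "g \<in> idealizer L H" and k: "k \<in> idealizer L H"
  shows "\<lbrace>g,k\<rbrace> \<in> idealizer L H"
proof -
  interpret H: subgroup H L using H by (simp add: mla_subalgebra_def)
  interpret N: subgroup "idealizer L H" L by (rule idealizer_subgroup [OF H])
  have gk [simp]: "g \<in> carrier L" "k \<in> carrier L"
    using g k by (auto dest: idealizerD(1))
  have left: "\<lbrace>n,h\<rbrace> \<in> H" if "n \<in> idealizer L H" "h \<in> H" for n h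
    using that by (rule idealizerD(4))
  have right: "\<lbrace>h,n\<rbrace> \<in> H" if "n \<in> idealizer L H" "h \<in> H" for n h
    using H.m_inv_closed [OF left [OF that]] that idealizerD(1) [OF that(1)]
    by (simp add: bracket_antisym)
  have conj: "conjugate L n n' \<in> idealizer L H"
    if "n \<in> idealizer L H" "n' \<in> idealizer L H" for n n'
    unfolding conjugate_def using that by simp
  have sub: "h \<in> idealizer L H" if "h \<in> H" for h
    using subalgebra_subset_idealizer [OF H] that by blast
  have "\<lbrace>\<lbrace>g,k\<rbrace>,h\<rbrace> \<in> H" if h: "h \<in> H" for h
  proof -
    define c where "c = conjugate L h (inv k)"
    have c: "c \<in> H" using idealizerD(3) [OF k h] by (simp add: c_def)
    have hc: "h = conjugate L c k" using h by (simp add: c_def)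
    define u where "u = \<lbrace>\<lbrace>k,c\<rbrace>,conjugate L g c\<rbrace>"
    define v where "v = \<lbrace>\<lbrace>c,g\<rbrace>,conjugate L k g\<rbrace>"
    have uv: "u \<in> H" "v \<in> H" unfolding u_def v_def
      by (intro right [OF conj [OF g sub [OF c]] left [OF k c]]
          right [OF conj [OF k g] right [OF g c]])+
    have "\<lbrace>\<lbrace>g,k\<rbrace>,h\<rbrace> \<otimes> u \<otimes> v = \<one>"
      unfolding hc u_def v_def using bracket_jacobi [of g k c] c by simp
    then have "inv (u \<otimes> v) = \<lbrace>\<lbrace>g,k\<rbrace>,h\<rbrace>"
      using uv h by (intro inv_equality) (simp_all add: m_assoc)
    moreover have "inv (u \<otimes> v) \<in> H" using uv by (intro H.m_inv_closed H.m_closed)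
    ultimately show ?thesis by simp
  qed
  moreover have "conjugate L h (inv \<lbrace>g,k\<rbrace>) \<in> H" if "h \<in> H" for h
    using idealizer_bracket_normalizes [OF H k g that] by (simp add: bracket_antisym)
  ultimately show ?thesis
    using idealizer_bracket_normalizes [OF H g k] by (intro idealizerI) simp_all
qed

text \<open>Products and brackets in the idealizer are well defined modulo \<open>H\<close>, an ideal of it.\<close>

lemma idealizer_mult_coset:
  assumes H: "mla_subalgebra H L" and gk: "g \<in> idealizer L H" "k \<in> idealizer L H"
    and d: "a \<in> H" "b \<in> H"
  obtains c where "c \<in> H" "(a \<otimes> g) \<otimes> (b \<otimes> k) = c \<otimes> (g \<otimes> k)"
proof
  interpret H: subgroup H L using H by (simp add: mla_subalgebra_def)
  have [simp]: "g \<in> carrier L" "k \<in> carrier L" using gk by (auto dest: idealizerD(1))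
  show "a \<otimes> conjugate L b g \<in> H" using d idealizerD(2) [OF gk(1) d(2)] by simp
  show "(a \<otimes> g) \<otimes> (b \<otimes> k) = (a \<otimes> conjugate L b g) \<otimes> (g \<otimes> k)"
    using d by (simp add: conjugate_def word_simps)
qed

lemma idealizer_bracket_coset:
  assumes H: "mla_subalgebra H L" and gk: "g \<in> idealizer L H" "k \<in> idealizer L H"
    and d: "a \<in> H" "b \<in> H"
  obtains c where "c \<in> H" "\<lbrace>a \<otimes> g, b \<otimes> k\<rbrace> = c \<otimes> \<lbrace>g,k\<rbrace>"
proof
  interpret H: subgroup H L using H by (simp add: mla_subalgebra_def)
  have [simp]: "g \<in> carrier L" "k \<in> carrier L" "a \<in> carrier L" "b \<in> carrier L"
    using gk d by (auto dest: idealizerD(1))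
  have N: "\<lbrace>g,k\<rbrace> \<in> idealizer L H" by (rule idealizer_bracket [OF H gk])
  define u where "u = conjugate L \<lbrace>g,b\<rbrace> a"
  define v where "v = inv (a \<otimes> b) \<otimes> \<lbrace>a,b\<rbrace> \<otimes> conjugate L \<lbrace>a,k\<rbrace> b"
  have "\<lbrace>g,b\<rbrace> \<in> H" using idealizerD(4) [OF gk(1) d(2)] .
  moreover have "\<lbrace>k,a\<rbrace> \<in> H" using idealizerD(4) [OF gk(2) d(1)] .
  then have "\<lbrace>a,k\<rbrace> \<in> H" using H.m_inv_closed [of "\<lbrace>k,a\<rbrace>"] by (simp add: bracket_antisym)
  moreover have "\<lbrace>a,b\<rbrace> \<in> H" using H d by (auto simp: mla_subalgebra_def)
  ultimately have uv: "u \<in> H" "v \<in> H" using d by (auto simp: u_def v_def conjugate_def)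
  show "u \<otimes> (a \<otimes> b) \<otimes> conjugate L v \<lbrace>g,k\<rbrace> \<in> H"
    using uv d idealizerD(2) [OF N uv(2)] by simp
  show "\<lbrace>a \<otimes> g, b \<otimes> k\<rbrace> = u \<otimes> (a \<otimes> b) \<otimes> conjugate L v \<lbrace>g,k\<rbrace> \<otimes> \<lbrace>g,k\<rbrace>"
    using uv by (simp add: bracket_mult_mult u_def v_def conjugate_def word_simps)
qed

end

section \<open>Products and homomorphic images\<close>

definition mla_prod ::
  "('a, 'm) mult_lie_scheme \<Rightarrow> ('b, 'n) mult_lie_scheme \<Rightarrow> ('a \<times> 'b) mult_lie" where
  "mla_prod L M = \<lparr>carrier = carrier L \<times> carrier M,
     mult = (\<lambda>(a, b) (c, d). (a \<otimes>\<^bsub>L\<^esub> c, b \<otimes>\<^bsub>M\<^esub> d)), one = (\<one>\<^bsub>L\<^esub>, \<one>\<^bsub>M\<^esub>),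
     bracket = (\<lambda>(a, b) (c, d). (\<lbrace>a,c\<rbrace>\<^bsub>L\<^esub>, \<lbrace>b,d\<rbrace>\<^bsub>M\<^esub>))\<rparr>"

lemma mla_prod_simps [simp]:
  "carrier (mla_prod L M) = carrier L \<times> carrier M"
  "(a, b) \<otimes>\<^bsub>mla_prod L M\<^esub> (c, d) = (a \<otimes>\<^bsub>L\<^esub> c, b \<otimes>\<^bsub>M\<^esub> d)"
  "\<one>\<^bsub>mla_prod L M\<^esub> = (\<one>\<^bsub>L\<^esub>, \<one>\<^bsub>M\<^esub>)"
  "\<lbrace>(a, b),(c, d)\<rbrace>\<^bsub>mla_prod L M\<^esub> = (\<lbrace>a,c\<rbrace>\<^bsub>L\<^esub>, \<lbrace>b,d\<rbrace>\<^bsub>M\<^esub>)"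
  by (simp_all add: mla_prod_def)

context
  fixes L :: "('a, 'm) mult_lie_scheme" and M :: "('b, 'n) mult_lie_scheme"
  assumes L: "multiplicative_lie_algebra L" and M: "multiplicative_lie_algebra M"
begin

interpretation L: multiplicative_lie_algebra L by (rule L)
interpretation M: multiplicative_lie_algebra M by (rule M)

lemma group_mla_prod: "group (mla_prod L M)"
proof (rule groupI)
  fix x assume "x \<in> carrier (mla_prod L M)"
  then show "\<exists>y\<in>carrier (mla_prod L M). y \<otimes>\<^bsub>mla_prod L M\<^esub> x = \<one>\<^bsub>mla_prod L M\<^esub>"
    by (intro bexI [of _ "(inv\<^bsub>L\<^esub> fst x, inv\<^bsub>M\<^esub> snd x)"]) auto
qed (auto simp: L.m_assoc M.m_assoc)

lemma inv_mla_prod [simp]: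
  "\<lbrakk>a \<in> carrier L; b \<in> carrier M\<rbrakk> \<Longrightarrow>
    inv\<^bsub>mla_prod L M\<^esub> (a, b) = (inv\<^bsub>L\<^esub> a, inv\<^bsub>M\<^esub> b)"
  by (rule group.inv_equality [OF group_mla_prod]) auto

lemma conjugate_mla_prod [simp]:
  "\<lbrakk>c \<in> carrier L; d \<in> carrier M\<rbrakk> \<Longrightarrow>
    conjugate (mla_prod L M) (a, b) (c, d) = (conjugate L a c, conjugate M b d)"
  by (simp add: conjugate_def)

lemma mla_prod_mla: "multiplicative_lie_algebra (mla_prod L M)"
proof -
  interpret group "mla_prod L M" by (rule group_mla_prod)
  show ?thesis
    by unfold_locales
      (auto simp: L.bracket_mult_right L.bracket_mult_left L.bracket_jacobi L.bracket_conjugate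
         M.bracket_mult_right M.bracket_mult_left M.bracket_jacobi M.bracket_conjugate)
qed

end

text \<open>The axioms are equations, so they pass to any structure that is an image.\<close>

lemma image_mla:
  fixes L :: "('a, 'm) mult_lie_scheme" and M :: "('b, 'n) mult_lie_scheme"
  assumes L: "multiplicative_lie_algebra L"
    and onto: "f ` carrier L = carrier M"
    and one: "f \<one>\<^bsub>L\<^esub> = \<one>\<^bsub>M\<^esub>"
    and mult: "\<And>x y. \<lbrakk>x \<in> carrier L; y \<in> carrier L\<rbrakk> \<Longrightarrow> f x \<otimes>\<^bsub>M\<^esub> f y = f (x \<otimes>\<^bsub>L\<^esub> y)"
    and bracket: "\<And>x y. \<lbrakk>x \<in> carrier L; y \<in> carrier L\<rbrakk> \<Longrightarrow> \<lbrace>f x,f y\<rbrace>\<^bsub>M\<^esub> = f \<lbrace>x,y\<rbrace>\<^bsub>L\<^esub>"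
  shows "multiplicative_lie_algebra M"
proof -
  interpret L: multiplicative_lie_algebra L by (rule L)
  have closed: "f x \<in> carrier M" if "x \<in> carrier L" for x using that onto by blast
  have lift: "\<exists>x\<in>carrier L. y = f x" if "y \<in> carrier M" for y using that onto by blast
  interpret M: group M
  proof (rule groupI)
    show "\<one>\<^bsub>M\<^esub> \<in> carrier M" using closed [of "\<one>\<^bsub>L\<^esub>"] one by simp
  next
    fix y assume "y \<in> carrier M"
    then obtain x where x: "x \<in> carrier L" "y = f x" using lift by blast
    then show "\<one>\<^bsub>M\<^esub> \<otimes>\<^bsub>M\<^esub> y = y" by (simp add: one [symmetric] mult)
    show "\<exists>z\<in>carrier M. z \<otimes>\<^bsub>M\<^esub> y = \<one>\<^bsub>M\<^esub>"
      using x by (intro bexI [of _ "f (inv\<^bsub>L\<^esub> x)"]) (auto simp: mult one closed)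
  next
    fix a b assume "a \<in> carrier M" "b \<in> carrier M"
    then obtain x y where "x \<in> carrier L" "a = f x" "y \<in> carrier L" "b = f y"
      using lift by blast
    then show "a \<otimes>\<^bsub>M\<^esub> b \<in> carrier M" by (simp add: mult closed)
    fix c assume "c \<in> carrier M"
    then obtain z where "z \<in> carrier L" "c = f z" using lift by blast
    then show "a \<otimes>\<^bsub>M\<^esub> b \<otimes>\<^bsub>M\<^esub> c = a \<otimes>\<^bsub>M\<^esub> (b \<otimes>\<^bsub>M\<^esub> c)"
      using \<open>x \<in> carrier L\<close> \<open>a = f x\<close> \<open>y \<in> carrier L\<close> \<open>b = f y\<close>
      by (simp add: mult L.m_assoc)
  qed
  have inv: "inv\<^bsub>M\<^esub> f x = f (inv\<^bsub>L\<^esub> x)" if "x \<in> carrier L" for x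
    using that by (intro M.inv_equality) (simp_all add: mult one closed)
  have conj: "conjugate M (f x) (f z) = f (conjugate L x z)"
    if "x \<in> carrier L" "z \<in> carrier L" for x z
    using that by (simp add: conjugate_def inv mult)
  show ?thesis
  proof unfold_locales
    fix a assume "a \<in> carrier M"
    then obtain x where x: "x \<in> carrier L" "a = f x" using lift by blast
    then show "\<lbrace>a,a\<rbrace>\<^bsub>M\<^esub> = \<one>\<^bsub>M\<^esub>" by (simp add: bracket one)
    fix b assume "b \<in> carrier M"
    then obtain y where y: "y \<in> carrier L" "b = f y" using lift by blast
    then show "\<lbrace>a,b\<rbrace>\<^bsub>M\<^esub> \<in> carrier M" using x by (simp add: bracket closed)
    fix c assume "c \<in> carrier M"
    then obtain z where z: "z \<in> carrier L" "c = f z" using lift by blast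
    show "\<lbrace>a,b \<otimes>\<^bsub>M\<^esub> c\<rbrace>\<^bsub>M\<^esub> = \<lbrace>a,b\<rbrace>\<^bsub>M\<^esub> \<otimes>\<^bsub>M\<^esub> conjugate M \<lbrace>a,c\<rbrace>\<^bsub>M\<^esub> b"
      using x y z by (simp add: mult bracket conj L.bracket_mult_right)
    show "\<lbrace>a \<otimes>\<^bsub>M\<^esub> b,c\<rbrace>\<^bsub>M\<^esub> = conjugate M \<lbrace>b,c\<rbrace>\<^bsub>M\<^esub> a \<otimes>\<^bsub>M\<^esub> \<lbrace>a,c\<rbrace>\<^bsub>M\<^esub>"
      using x y z by (simp add: mult bracket conj L.bracket_mult_left)
    show "\<lbrace>\<lbrace>a,b\<rbrace>\<^bsub>M\<^esub>,conjugate M c b\<rbrace>\<^bsub>M\<^esub> \<otimes>\<^bsub>M\<^esub> \<lbrace>\<lbrace>b,c\<rbrace>\<^bsub>M\<^esub>,conjugate M a c\<rbrace>\<^bsub>M\<^esub> \<otimes>\<^bsub>M\<^esub>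
        \<lbrace>\<lbrace>c,a\<rbrace>\<^bsub>M\<^esub>,conjugate M b a\<rbrace>\<^bsub>M\<^esub> = \<one>\<^bsub>M\<^esub>"
      using x y z by (simp add: mult bracket conj one L.bracket_jacobi)
    show "conjugate M \<lbrace>a,b\<rbrace>\<^bsub>M\<^esub> c = \<lbrace>conjugate M a c,conjugate M b c\<rbrace>\<^bsub>M\<^esub>"
      using x y z by (simp add: bracket conj L.bracket_conjugate)
  qed
qed

section \<open>The algebraic center\<close>

context multiplicative_lie_algebra
begin

lemma alg_centerD:
  assumes "w \<in> alg_center L"
  shows "w \<in> carrier L"
    and "a \<in> carrier L \<Longrightarrow> a \<otimes> w = w \<otimes> a"
    and "a \<in> carrier L \<Longrightarrow> \<lbrace>w,a\<rbrace> = \<one>"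
    and "a \<in> carrier L \<Longrightarrow> \<lbrace>a,w\<rbrace> = \<one>"
  using assms by (simp_all add: alg_center_def)

lemma alg_centerI:
  assumes "w \<in> carrier L"
    and "\<And>a. a \<in> carrier L \<Longrightarrow> w \<otimes> a = a \<otimes> w"
    and "\<And>a. a \<in> carrier L \<Longrightarrow> \<lbrace>w,a\<rbrace> = \<one>"
  shows "w \<in> alg_center L"
proof -
  have "\<lbrace>a,w\<rbrace> = \<one>" if "a \<in> carrier L" for a
    using bracket_antisym [of w a] assms that by simp
  then show ?thesis using assms by (simp add: alg_center_def)
qed

lemma alg_center_subgroup: "subgroup (alg_center L) L"
proof
  fix w v assume wv: "w \<in> alg_center L" "v \<in> alg_center L"
  have [simp]: "w \<in> carrier L" "v \<in> carrier L" using wv by (auto dest: alg_centerD(1))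
  show "w \<otimes> v \<in> alg_center L"
  proof (rule alg_centerI)
    fix a assume a: "a \<in> carrier L"
    then have "w \<otimes> v \<otimes> a = w \<otimes> (a \<otimes> v)"
      by (simp add: m_assoc alg_centerD(2) [OF wv(2) a])
    also have "\<dots> = w \<otimes> a \<otimes> v" using a by (simp add: m_assoc)
    also have "\<dots> = a \<otimes> w \<otimes> v" using alg_centerD(2) [OF wv(1) a] by simp
    finally show "w \<otimes> v \<otimes> a = a \<otimes> (w \<otimes> v)" using a by (simp add: m_assoc)
  qed (use wv in \<open>simp_all add: bracket_mult_left alg_centerD(3)\<close>)
next
  fix w assume w: "w \<in> alg_center L"
  note [simp] = alg_centerD(1,3) [OF w]
  show "inv w \<in> alg_center L"
  proof (rule alg_centerI)
    fix a assume a: "a \<in> carrier L"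
    then have "inv w \<otimes> (w \<otimes> a) \<otimes> inv w = inv w \<otimes> (a \<otimes> w) \<otimes> inv w"
      using alg_centerD(2) [OF w] by simp
    then show "inv w \<otimes> a = a \<otimes> inv w" using a by (simp add: word_simps)
  qed (simp_all add: bracket_inv_left)
qed (auto simp: alg_center_def)

lemma alg_center_comm: "\<lbrakk>w \<in> alg_center L; a \<in> carrier L\<rbrakk> \<Longrightarrow> w \<otimes> a = a \<otimes> w"
  by (rule alg_centerD(2) [symmetric])

lemmas alg_center_closed [simp] = subgroup.m_closed [OF alg_center_subgroup]
  subgroup.m_inv_closed [OF alg_center_subgroup] subgroup.one_closed [OF alg_center_subgroup]

lemma center_algebra_simps [simp]:
  "carrier (center_algebra L) = alg_center L"
  "a \<otimes>\<^bsub>center_algebra L\<^esub> b = a \<otimes> b"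
  "\<one>\<^bsub>center_algebra L\<^esub> = \<one>"
  by (simp_all add: center_algebra_def)

lemma center_algebra_inv [simp]:
  "w \<in> alg_center L \<Longrightarrow> inv\<^bsub>center_algebra L\<^esub> w = inv w"
  unfolding center_algebra_def by (rule m_inv_consistent [OF alg_center_subgroup])

end

lemma (in comm_group) quotient_eq_iff:
  assumes "a \<in> carrier G" "b \<in> carrier G" "c \<in> carrier G" "d \<in> carrier G"
  shows "a \<otimes> inv b = c \<otimes> inv d \<longleftrightarrow> a \<otimes> d = c \<otimes> b"
proof
  assume "a \<otimes> inv b = c \<otimes> inv d"
  then have "a \<otimes> inv b \<otimes> (b \<otimes> d) = c \<otimes> inv d \<otimes> (d \<otimes> b)" using assms by (simp add: m_comm)
  then show "a \<otimes> d = c \<otimes> b" using assms by (simp add: word_simps)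
next
  assume "a \<otimes> d = c \<otimes> b"
  then have "a \<otimes> d \<otimes> (inv d \<otimes> inv b) = c \<otimes> b \<otimes> (inv b \<otimes> inv d)"
    using assms by (simp add: m_comm)
  then show "a \<otimes> inv b = c \<otimes> inv d" using assms by (simp add: word_simps)
qed

lemma (in multiplicative_lie_algebra) comm_group_center: "comm_group (center_algebra L)"
proof -
  interpret group "center_algebra L"
    unfolding center_algebra_def by (rule subgroup.subgroup_is_group [OF alg_center_subgroup])
      (rule is_group)
  show ?thesis
    by (rule group_comm_groupI) (simp add: alg_center_comm alg_centerD(1))
qed

section \<open>Extensions with a section\<close>

text \<open>
  An extension together with a section whose action terms are exactly \<open>\<chi>\<close>, with the exactness
  conditions stated elementwise. The section makes \<open>pr\<close> onto.
\<close>

locale realization =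
  Q: multiplicative_lie_algebra Q + I: multiplicative_lie_algebra I + multiplicative_lie_algebra A
  for Q :: "'q mult_lie" and I :: "'i mult_lie" and A :: "'e mult_lie" (structure) +
  fixes i :: "'i \<Rightarrow> 'e" and pr :: "'e \<Rightarrow> 'q" and \<chi> :: "('q, 'i) action_terms" and l :: "'q \<Rightarrow> 'e"
  assumes i_closed [simp]: "a \<in> carrier I \<Longrightarrow> i a \<in> carrier A"
    and i_mult [simp]: "\<lbrakk>a \<in> carrier I; b \<in> carrier I\<rbrakk> \<Longrightarrow> i (a \<otimes>\<^bsub>I\<^esub> b) = i a \<otimes> i b"
    and i_bracket [simp]: "\<lbrakk>a \<in> carrier I; b \<in> carrier I\<rbrakk> \<Longrightarrow> i \<lbrace>a,b\<rbrace>\<^bsub>I\<^esub> = \<lbrace>i a,i b\<rbrace>"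
    and i_inj: "inj_on i (carrier I)"
    and pr_closed [simp]: "p \<in> carrier A \<Longrightarrow> pr p \<in> carrier Q"
    and pr_mult [simp]: "\<lbrakk>p \<in> carrier A; q \<in> carrier A\<rbrakk> \<Longrightarrow> pr (p \<otimes> q) = pr p \<otimes>\<^bsub>Q\<^esub> pr q"
    and pr_bracket [simp]: "\<lbrakk>p \<in> carrier A; q \<in> carrier A\<rbrakk> \<Longrightarrow> pr \<lbrace>p,q\<rbrace> = \<lbrace>pr p,pr q\<rbrace>\<^bsub>Q\<^esub>"
    and pr_i [simp]: "a \<in> carrier I \<Longrightarrow> pr (i a) = \<one>\<^bsub>Q\<^esub>"
    and kernel_pr: "\<lbrakk>p \<in> carrier A; pr p = \<one>\<^bsub>Q\<^esub>\<rbrakk> \<Longrightarrow> \<exists>a\<in>carrier I. p = i a"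
    and l_closed [simp]: "x \<in> carrier Q \<Longrightarrow> l x \<in> carrier A"
    and pr_l [simp]: "x \<in> carrier Q \<Longrightarrow> pr (l x) = x"
    and l_one: "l \<one>\<^bsub>Q\<^esub> = \<one>"
    and sigma_closed [simp]: "\<lbrakk>x \<in> carrier Q; a \<in> carrier I\<rbrakk> \<Longrightarrow> sigma \<chi> x a \<in> carrier I"
    and tau_closed [simp]: "\<lbrakk>x \<in> carrier Q; a \<in> carrier I\<rbrakk> \<Longrightarrow> tau \<chi> x a \<in> carrier I"
    and nu_closed [simp]: "\<lbrakk>x \<in> carrier Q; a \<in> carrier I\<rbrakk> \<Longrightarrow> nu \<chi> x a \<in> carrier I"
    and conjugate_l: "\<lbrakk>x \<in> carrier Q; a \<in> carrier I\<rbrakk> \<Longrightarrow> conjugate A (i a) (l x) = i (sigma \<chi> x a)"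
    and bracket_l_left: "\<lbrakk>x \<in> carrier Q; a \<in> carrier I\<rbrakk> \<Longrightarrow> \<lbrace>l x,i a\<rbrace> = i (tau \<chi> x a)"
    and bracket_l_right: "\<lbrakk>x \<in> carrier Q; a \<in> carrier I\<rbrakk> \<Longrightarrow> \<lbrace>i a,l x\<rbrace> = i (nu \<chi> x a)"
begin

abbreviation Z where "Z \<equiv> alg_center I"
abbreviation B where "B \<equiv> center_algebra I"

lemma Z_closed [simp]: "w \<in> Z \<Longrightarrow> w \<in> carrier I"
  by (rule I.alg_centerD)

lemma i_eq_iff [simp]: "\<lbrakk>a \<in> carrier I; b \<in> carrier I\<rbrakk> \<Longrightarrow> i a = i b \<longleftrightarrow> a = b"
  using i_inj by (auto dest: inj_onD)

lemma i_one [simp]: "i \<one>\<^bsub>I\<^esub> = \<one>"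
  by (rule idempotent_is_one) (simp_all flip: i_mult)

lemma i_inv [simp]: "a \<in> carrier I \<Longrightarrow> i (inv\<^bsub>I\<^esub> a) = inv (i a)"
  by (rule inv_equality [symmetric]) (simp_all flip: i_mult)

lemma pr_one [simp]: "pr \<one> = \<one>\<^bsub>Q\<^esub>"
  using pr_i [of "\<one>\<^bsub>I\<^esub>"] by (simp del: pr_i)

lemma pr_inv [simp]: "p \<in> carrier A \<Longrightarrow> pr (inv p) = inv\<^bsub>Q\<^esub> pr p"
  by (rule Q.inv_equality [symmetric]) (simp_all flip: pr_mult)

lemma same_fibre:
  assumes "p \<in> carrier A" "q \<in> carrier A" "pr p = pr q"
  obtains u where "u \<in> carrier I" "p = i u \<otimes> q"
proof -
  obtain u where u: "u \<in> carrier I" "p \<otimes> inv q = i u"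
    using kernel_pr [of "p \<otimes> inv q"] assms by auto
  then have "p = i u \<otimes> q" using assms by (simp flip: u(2) add: word_simps)
  then show thesis using u that by blast
qed

lemma over_section:
  assumes "p \<in> carrier A"
  obtains u where "u \<in> carrier I" "p = i u \<otimes> l (pr p)"
  using same_fibre [of p "l (pr p)"] assms by auto

lemma conjugate_i:
  assumes "p \<in> carrier A" "a \<in> carrier I"
  obtains b where "b \<in> carrier I" "conjugate A (i a) p = i b"
  using kernel_pr [of "conjugate A (i a) p"] assms by (auto simp: conjugate_def)

lemma bracket_i:
  assumes "p \<in> carrier A" "a \<in> carrier I"
  obtains b where "b \<in> carrier I" "\<lbrace>p,i a\<rbrace> = i b"
  using kernel_pr [of "\<lbrace>p,i a\<rbrace>"] assms by auto

lemma Z_i_comm: "\<lbrakk>w \<in> Z; a \<in> carrier I\<rbrakk> \<Longrightarrow> i a \<otimes> i w = i w \<otimes> i a"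
  using I.alg_centerD(2) by (simp flip: i_mult)

lemma Z_i [simp]:
  assumes "w \<in> Z" "a \<in> carrier I"
  shows "\<lbrace>i w,i a\<rbrace> = \<one>" "\<lbrace>i a,i w\<rbrace> = \<one>"
    and "conjugate A (i w) (i a) = i w" "conjugate A (i a) (i w) = i a"
  using I.alg_centerD(3,4) [OF assms(1)] Z_i_comm [OF assms] assms
  by (simp_all add: conjugate_commute flip: i_bracket)

lemma central_in_Z:
  assumes c: "c \<in> carrier A" "pr c = \<one>\<^bsub>Q\<^esub>"
    and conj: "\<And>a. a \<in> carrier I \<Longrightarrow> c \<otimes> i a = i a \<otimes> c"
    and bracket: "\<And>a. a \<in> carrier I \<Longrightarrow> \<lbrace>c,i a\<rbrace> = \<one>"
  obtains w where "w \<in> Z" "c = i w"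
proof -
  obtain w where w: "w \<in> carrier I" "c = i w" using kernel_pr c by blast
  have "w \<in> Z"
  proof (rule I.alg_centerI [OF w(1)])
    fix a assume a: "a \<in> carrier I"
    have "i (w \<otimes>\<^bsub>I\<^esub> a) = i (a \<otimes>\<^bsub>I\<^esub> w)" using conj a w by simp
    then show "w \<otimes>\<^bsub>I\<^esub> a = a \<otimes>\<^bsub>I\<^esub> w" using a w by (simp del: i_mult)
    have "i \<lbrace>w,a\<rbrace>\<^bsub>I\<^esub> = i \<one>\<^bsub>I\<^esub>" using bracket a w by simp
    then show "\<lbrace>w,a\<rbrace>\<^bsub>I\<^esub> = \<one>\<^bsub>I\<^esub>" using a w by (simp del: i_bracket i_one)
  qed
  then show thesis using w that by blast
qed

text \<open>
  Write \<open>p = c q\<close>. Every \<open>a\<close> in the kernel is \<open>q b q\<inverse>\<close> for some \<open>b\<close> in the kernel, and \<open>c q\<close> conjugates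
  \<open>b\<close> to the same \<open>a\<close>, so \<open>c\<close> commutes with \<open>a\<close>. Then \<open>{c q, a} = {q,a} {c,a}\<close>, which forces \<open>{c,a} = 1\<close>.
\<close>

lemma alike_differ_by_Z:
  assumes p: "p \<in> carrier A" "q \<in> carrier A" "pr p = pr q"
    and conj: "\<And>a. a \<in> carrier I \<Longrightarrow> conjugate A (i a) p = conjugate A (i a) q"
    and bracket: "\<And>a. a \<in> carrier I \<Longrightarrow> \<lbrace>p,i a\<rbrace> = \<lbrace>q,i a\<rbrace>"
  obtains w where "w \<in> Z" "p = i w \<otimes> q"
proof -
  obtain c where c: "c \<in> carrier I" "p = i c \<otimes> q" using same_fibre p by blast
  have commutes: "i c \<otimes> i a = i a \<otimes> i c" if a: "a \<in> carrier I" for a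
  proof -
    obtain b where b: "b \<in> carrier I" "conjugate A (i a) (inv q) = i b"
      using conjugate_i [of "inv q" a] a p by auto
    then have ab: "i a = conjugate A (i b) q" using p a by (metis conjugate_inv_cancel i_closed)
    have "conjugate A (i b) p = conjugate A (i b) q" by (rule conj) (rule b)
    then have "conjugate A (i a) (i c) = i a"
      using p b c(1) unfolding ab c(2) by (simp add: conjugate_by_mult)
    then have "i c \<otimes> i a \<otimes> inv (i c) \<otimes> i c = i a \<otimes> i c" by (simp add: conjugate_def)
    then show ?thesis using a c by (simp add: word_simps)
  qed
  have trivial: "\<lbrace>i c,i a\<rbrace> = \<one>" if a: "a \<in> carrier I" for a
  proof -
    obtain b where b: "b \<in> carrier I" "\<lbrace>q,i a\<rbrace> = i b" using bracket_i a p by blast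
    have "\<lbrace>p,i a\<rbrace> = conjugate A \<lbrace>q,i a\<rbrace> (i c) \<otimes> \<lbrace>i c,i a\<rbrace>"
      using a p c by (simp add: bracket_mult_left)
    also have "conjugate A \<lbrace>q,i a\<rbrace> (i c) = \<lbrace>q,i a\<rbrace>"
      using b c commutes by (simp add: conjugate_commute)
    finally have *: "\<lbrace>q,i a\<rbrace> \<otimes> \<lbrace>i c,i a\<rbrace> = \<lbrace>q,i a\<rbrace>" using bracket [OF a] by simp
    show ?thesis by (rule l_cancel_one [THEN iffD1, OF _ _ *]) (use a p c in simp_all)
  qed
  obtain w where w: "w \<in> Z" "i c = i w"
    by (rule central_in_Z [OF i_closed [OF c(1)] pr_i [OF c(1)] commutes trivial])
  show thesis by (rule that [OF w(1)]) (use c(2) w(2) in simp)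
qed

text \<open>
  The center of \<open>I\<close> is an ideal of the whole extension, which is why the action terms restrict to it.
  For conjugation: \<open>p\<close> permutes the kernel and conjugation preserves products and brackets.
\<close>

lemma conjugate_Z:
  assumes p: "p \<in> carrier A" and w: "w \<in> Z"
  obtains v where "v \<in> Z" "conjugate A (i w) p = i v"
proof -
  have [simp]: "w \<in> carrier I" using w by simp
  have *: "conjugate A (i w) p \<otimes> i a = i a \<otimes> conjugate A (i w) p \<and> \<lbrace>conjugate A (i w) p,i a\<rbrace> = \<one>"
    if a: "a \<in> carrier I" for a
  proof -
    obtain b where b: "b \<in> carrier I" "conjugate A (i a) (inv p) = i b"
      using conjugate_i [of "inv p" a] a p by auto
    then have ab: "i a = conjugate A (i b) p" using p a by (metis conjugate_inv_cancel i_closed)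
    show ?thesis unfolding ab
      using p w b Z_i_comm [OF w b(1)] by (simp flip: conjugate_mult bracket_conjugate)
  qed
  show thesis
    by (rule central_in_Z [of "conjugate A (i w) p"]) (use * p that in \<open>auto simp: conjugate_def\<close>)
qed

text \<open>
  Conjugating \<open>{p,w}\<close> by \<open>a\<close> gives \<open>{d p, w} = {p,w}\<^sup>d\<close> with \<open>d = a (p a p\<inverse>)\<inverse>\<close>, so \<open>{p,w}\<close> commutes
  with \<open>p a p\<inverse>\<close>, which ranges over the whole kernel; brackets with \<open>{p,w}\<close> vanish by Jacobi.
\<close>

lemma bracket_Z:
  assumes p: "p \<in> carrier A" and w: "w \<in> Z"
  obtains v where "v \<in> Z" "\<lbrace>p,i w\<rbrace> = i v"
proof -
  have [simp]: "w \<in> carrier I" using w by simp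
  have 1: "\<lbrace>p,i w\<rbrace> \<otimes> i b = i b \<otimes> \<lbrace>p,i w\<rbrace>" if b: "b \<in> carrier I" for b
  proof -
    obtain a where a: "a \<in> carrier I" "conjugate A (i b) (inv p) = i a"
      using conjugate_i [of "inv p" b] b p by auto
    then have ab: "i b = conjugate A (i a) p" using p b by (metis conjugate_inv_cancel i_closed)
    \<comment> \<open>\<open>b\<close> is given and \<open>a\<close> chosen with \<open>p a p\<inverse> = b\<close>; the factor \<open>d\<close> is \<open>a b\<inverse>\<close>.\<close>
    have pa: "conjugate A p (i a) = i (a \<otimes>\<^bsub>I\<^esub> inv\<^bsub>I\<^esub> b) \<otimes> p"
      using a b p by (simp add: ab conjugate_def word_simps)
    have "conjugate A \<lbrace>p,i w\<rbrace> (i a) = \<lbrace>i (a \<otimes>\<^bsub>I\<^esub> inv\<^bsub>I\<^esub> b) \<otimes> p,i w\<rbrace>"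
      using a b p w by (simp add: bracket_conjugate pa [symmetric] del: i_mult i_inv)
    also have "\<dots> = conjugate A \<lbrace>p,i w\<rbrace> (i (a \<otimes>\<^bsub>I\<^esub> inv\<^bsub>I\<^esub> b))"
      using a b p w by (simp add: bracket_mult_left del: i_mult i_inv)
    also have "\<dots> = conjugate A (conjugate A \<lbrace>p,i w\<rbrace> (inv (i b))) (i a)"
      using a b p by (simp add: conjugate_by_mult)
    finally have "conjugate A \<lbrace>p,i w\<rbrace> (i a) = conjugate A (conjugate A \<lbrace>p,i w\<rbrace> (inv (i b))) (i a)" .
    then have "\<lbrace>p,i w\<rbrace> = conjugate A \<lbrace>p,i w\<rbrace> (inv (i b))"
      using a b p by (simp add: conjugate_def)
    then have "i b \<otimes> \<lbrace>p,i w\<rbrace> = i b \<otimes> conjugate A \<lbrace>p,i w\<rbrace> (inv (i b))" by simp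
    then show ?thesis using b p by (simp add: conjugate_def word_simps)
  qed
  have 2: "\<lbrace>\<lbrace>p,i w\<rbrace>,i b\<rbrace> = \<one>" if b: "b \<in> carrier I" for b
  proof -
    obtain v where v: "v \<in> Z" "conjugate A (i w) p = i v" using conjugate_Z p w by blast
    obtain c where c: "c \<in> carrier I" "\<lbrace>p,i b\<rbrace> = i c" using bracket_i p b by blast
    have "\<lbrace>i b,p\<rbrace> = i (inv\<^bsub>I\<^esub> c)" using c p b bracket_antisym [of p "i b"] by simp
    then have "\<lbrace>\<lbrace>i b,p\<rbrace>,conjugate A (i w) p\<rbrace> = \<one>" using v c by (simp del: i_inv)
    moreover have "conjugate A (i b) (i w) = i b" using w b by (simp add: conjugate_commute)
    ultimately show ?thesis using bracket_jacobi [of p "i w" "i b"] p b w by simp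
  qed
  show thesis
    by (rule central_in_Z [of "\<lbrace>p,i w\<rbrace>"]) (use 1 2 p that in auto)
qed

lemma terms_Z [simp]:
  assumes x: "x \<in> carrier Q" and w: "w \<in> Z"
  shows "sigma \<chi> x w \<in> Z" "tau \<chi> x w \<in> Z" "nu \<chi> x w \<in> Z"
proof -
  show "sigma \<chi> x w \<in> Z"
    using conjugate_Z [of "l x" w] x w by (auto simp: conjugate_l)
  obtain v where v: "v \<in> Z" "\<lbrace>l x,i w\<rbrace> = i v" using bracket_Z [of "l x" w] x w by auto
  then show "tau \<chi> x w \<in> Z" using x w by (auto simp: bracket_l_left)
  have "i (nu \<chi> x w) = i (inv\<^bsub>I\<^esub> v)"
    using v x w bracket_antisym [of "l x" "i w"] by (simp flip: bracket_l_right)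
  then have "nu \<chi> x w = inv\<^bsub>I\<^esub> v" using x v w by (simp del: i_inv)
  then show "nu \<chi> x w \<in> Z" using v by simp
qed

lemma mult_Z:
  assumes p: "p \<in> carrier A" and w: "w \<in> Z"
  shows "p \<otimes> i w = i (sigma \<chi> (pr p) w) \<otimes> p"
proof -
  obtain u where u: "u \<in> carrier I" "p = i u \<otimes> l (pr p)" using over_section p by blast
  define x where "x = pr p"
  have x: "x \<in> carrier Q" using p by (simp add: x_def)
  have pu: "p = i u \<otimes> l x" using u by (simp add: x_def)
  have "l x \<otimes> i w = conjugate A (i w) (l x) \<otimes> l x"
    using x w by (simp add: conjugate_def word_simps)
  then have "i u \<otimes> (l x \<otimes> i w) = i u \<otimes> i (sigma \<chi> x w) \<otimes> l x"
    using x w u by (simp add: conjugate_l m_assoc)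
  also have "\<dots> = i (sigma \<chi> x w) \<otimes> (i u \<otimes> l x)"
    using x w u(1) Z_i_comm [of "sigma \<chi> x w" u] by (simp add: m_assoc)
  finally have "p \<otimes> i w = i (sigma \<chi> x w) \<otimes> p"
    unfolding pu using x w u(1) by (simp add: m_assoc)
  then show ?thesis by (simp add: x_def)
qed

lemma bracket_Z_right:
  assumes p: "p \<in> carrier A" and w: "w \<in> Z"
  shows "\<lbrace>p,i w\<rbrace> = i (tau \<chi> (pr p) w)"
proof -
  obtain u where u: "u \<in> carrier I" "p = i u \<otimes> l (pr p)" using over_section p by blast
  have "\<lbrace>i u \<otimes> l (pr p),i w\<rbrace> = i (tau \<chi> (pr p) w)"
    using p w u(1) by (simp add: bracket_mult_left bracket_l_left)
  then show ?thesis using u(2) by simp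
qed

lemma bracket_Z_left:
  assumes p: "p \<in> carrier A" and w: "w \<in> Z"
  shows "\<lbrace>i w,p\<rbrace> = i (nu \<chi> (pr p) w)"
proof -
  obtain u where u: "u \<in> carrier I" "p = i u \<otimes> l (pr p)" using over_section p by blast
  have "\<lbrace>i w,i u \<otimes> l (pr p)\<rbrace> = i (nu \<chi> (pr p) w)"
    using p w u(1) by (simp add: bracket_mult_right bracket_l_right)
  then show ?thesis using u(2) by simp
qed

text \<open>The central factor by which \<open>{w p, v q}\<close> exceeds \<open>{p,q}\<close>, for \<open>p\<close> over \<open>x\<close> and \<open>q\<close> over \<open>y\<close>.\<close>

definition bracket_factor :: "'q \<Rightarrow> 'q \<Rightarrow> 'i \<Rightarrow> 'i \<Rightarrow> 'i" where
  "bracket_factor x y w v = w \<otimes>\<^bsub>I\<^esub> v \<otimes>\<^bsub>I\<^esub> tau \<chi> x v \<otimes>\<^bsub>I\<^esub>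
     sigma \<chi> \<lbrace>x,y\<rbrace>\<^bsub>Q\<^esub> (nu \<chi> y w \<otimes>\<^bsub>I\<^esub> inv\<^bsub>I\<^esub> w \<otimes>\<^bsub>I\<^esub> inv\<^bsub>I\<^esub> v)"

lemma bracket_factor_Z [simp]:
  "\<lbrakk>x \<in> carrier Q; y \<in> carrier Q; w \<in> Z; v \<in> Z\<rbrakk> \<Longrightarrow> bracket_factor x y w v \<in> Z"
  by (simp add: bracket_factor_def)

lemma mult_Z_mult:
  assumes p: "p \<in> carrier A" "q \<in> carrier A" and w: "w \<in> Z" "v \<in> Z"
  shows "(i w \<otimes> p) \<otimes> (i v \<otimes> q) = i (w \<otimes>\<^bsub>I\<^esub> sigma \<chi> (pr p) v) \<otimes> (p \<otimes> q)"
proof -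
  have "p \<otimes> (i v \<otimes> q) = i (sigma \<chi> (pr p) v) \<otimes> (p \<otimes> q)"
    using p w mult_Z [OF p(1) w(2)] by (simp flip: m_assoc)
  then show ?thesis using p w by (simp add: m_assoc)
qed

lemma bracket_Z_mult:
  assumes p: "p \<in> carrier A" "q \<in> carrier A" and w: "w \<in> Z" "v \<in> Z"
  shows "\<lbrace>i w \<otimes> p,i v \<otimes> q\<rbrace> = i (bracket_factor (pr p) (pr q) w v) \<otimes> \<lbrace>p,q\<rbrace>"
proof -
  define x y where "x = pr p" and "y = pr q"
  have xy: "x \<in> carrier Q" "y \<in> carrier Q" using p by (auto simp: x_def y_def)
  have "\<lbrace>i w \<otimes> p,i v \<otimes> q\<rbrace> = i (tau \<chi> x v) \<otimes> conjugate A \<lbrace>p,q\<rbrace> (i w \<otimes> i v) \<otimes> i (nu \<chi> y w)"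
    using p w xy by (simp add: bracket_mult_mult bracket_Z_left [OF p(2) w(1)]
        bracket_Z_right [OF p(1) w(2)] flip: x_def y_def)
  also have "\<dots> = i (tau \<chi> x v) \<otimes> (i w \<otimes> i v) \<otimes>
      (\<lbrace>p,q\<rbrace> \<otimes> i (nu \<chi> y w \<otimes>\<^bsub>I\<^esub> inv\<^bsub>I\<^esub> w \<otimes>\<^bsub>I\<^esub> inv\<^bsub>I\<^esub> v))"
  proof -
    have "inv (i w \<otimes> i v) \<otimes> i (nu \<chi> y w) = i (inv\<^bsub>I\<^esub> (w \<otimes>\<^bsub>I\<^esub> v) \<otimes>\<^bsub>I\<^esub> nu \<chi> y w)"
      using w xy by simp
    also have "inv\<^bsub>I\<^esub> (w \<otimes>\<^bsub>I\<^esub> v) \<otimes>\<^bsub>I\<^esub> nu \<chi> y w = nu \<chi> y w \<otimes>\<^bsub>I\<^esub> inv\<^bsub>I\<^esub> w \<otimes>\<^bsub>I\<^esub> inv\<^bsub>I\<^esub> v"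
      using w xy I.alg_center_comm [of "inv\<^bsub>I\<^esub> (w \<otimes>\<^bsub>I\<^esub> v)" "nu \<chi> y w"]
        I.alg_center_comm [of "inv\<^bsub>I\<^esub> w" "inv\<^bsub>I\<^esub> v"]
      by (simp add: I.inv_mult_group I.m_assoc)
    finally show ?thesis
      using p w xy by (simp add: conjugate_def m_assoc del: i_mult i_inv)
  qed
  also have "\<lbrace>p,q\<rbrace> \<otimes> i (nu \<chi> y w \<otimes>\<^bsub>I\<^esub> inv\<^bsub>I\<^esub> w \<otimes>\<^bsub>I\<^esub> inv\<^bsub>I\<^esub> v)
      = i (sigma \<chi> \<lbrace>x,y\<rbrace>\<^bsub>Q\<^esub> (nu \<chi> y w \<otimes>\<^bsub>I\<^esub> inv\<^bsub>I\<^esub> w \<otimes>\<^bsub>I\<^esub> inv\<^bsub>I\<^esub> v)) \<otimes> \<lbrace>p,q\<rbrace>"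
    using p w xy by (subst mult_Z) (simp_all flip: x_def y_def)
  also have "i (tau \<chi> x v) \<otimes> (i w \<otimes> i v) = i w \<otimes> i v \<otimes> i (tau \<chi> x v)"
    using w xy Z_i_comm [of "tau \<chi> x v" "w \<otimes>\<^bsub>I\<^esub> v"] by simp
  finally show ?thesis
    using p w xy by (simp add: bracket_factor_def m_assoc flip: x_def y_def)
qed

end

section \<open>Twisting an extension by a cocycle\<close>

context realization
begin

definition twist :: "('q, 'i) cochain \<Rightarrow> 'e mult_lie" where
  "twist S = \<lparr>carrier = carrier A, mult = (\<lambda>p q. i (fst S (pr p) (pr q)) \<otimes> (p \<otimes> q)), one = \<one>,
     bracket = (\<lambda>p q. i (snd S (pr p) (pr q)) \<otimes> \<lbrace>p,q\<rbrace>)\<rparr>"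

abbreviation cocycles where
  "cocycles \<equiv> compatible_cocycles Q B (restrict_terms \<chi> Z)"

abbreviation cocycle_mla where
  "cocycle_mla \<equiv> cocycle_algebra Q B (restrict_terms \<chi> Z)"

lemma twist_simps [simp]:
  "carrier (twist S) = carrier A"
  "p \<otimes>\<^bsub>twist S\<^esub> q = i (fst S (pr p) (pr q)) \<otimes> (p \<otimes> q)"
  "\<one>\<^bsub>twist S\<^esub> = \<one>"
  "\<lbrace>p,q\<rbrace>\<^bsub>twist S\<^esub> = i (snd S (pr p) (pr q)) \<otimes> \<lbrace>p,q\<rbrace>"
  by (simp_all add: twist_def)

lemma two_cocycle_closed:
  assumes "two_cocycle Q B S" "x \<in> carrier Q" "y \<in> carrier Q"
  shows "fst S x y \<in> Z" "snd S x y \<in> Z"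
  using assms by (auto simp: two_cocycle_def split: prod.splits)

lemma two_cocycle_one:
  assumes "two_cocycle Q B S" "x \<in> carrier Q"
  shows "fst S x \<one>\<^bsub>Q\<^esub> = \<one>\<^bsub>I\<^esub>" "fst S \<one>\<^bsub>Q\<^esub> x = \<one>\<^bsub>I\<^esub>"
    and "snd S x \<one>\<^bsub>Q\<^esub> = \<one>\<^bsub>I\<^esub>" "snd S \<one>\<^bsub>Q\<^esub> x = \<one>\<^bsub>I\<^esub>" "snd S x x = \<one>\<^bsub>I\<^esub>"
  using assms by (auto simp: two_cocycle_def split: prod.splits)

lemma Z_left_collect:
  "\<lbrakk>w \<in> Z; a \<in> carrier I; p \<in> carrier A\<rbrakk> \<Longrightarrow> i w \<otimes> (i a \<otimes> p) = i (a \<otimes>\<^bsub>I\<^esub> w) \<otimes> p"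
  using Z_i_comm [of w a] by (simp flip: m_assoc)

lemma twist_mult_Z:
  assumes coc: "two_cocycle Q B S" and p: "p \<in> carrier A" "q \<in> carrier A" and w: "w \<in> Z" "v \<in> Z"
  shows "(i w \<otimes> p) \<otimes>\<^bsub>twist S\<^esub> (i v \<otimes> q) =
    i (w \<otimes>\<^bsub>I\<^esub> sigma \<chi> (pr p) v \<otimes>\<^bsub>I\<^esub> fst S (pr p) (pr q)) \<otimes> (p \<otimes> q)"
proof -
  have "(i w \<otimes> p) \<otimes>\<^bsub>twist S\<^esub> (i v \<otimes> q) =
      i (fst S (pr p) (pr q)) \<otimes> (i (w \<otimes>\<^bsub>I\<^esub> sigma \<chi> (pr p) v) \<otimes> (p \<otimes> q))"
    using p w by (simp add: mult_Z_mult del: i_mult)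
  then show ?thesis
    using p w two_cocycle_closed [OF coc] by (simp add: Z_left_collect del: i_mult)
qed

lemma twist_bracket_Z:
  assumes coc: "two_cocycle Q B S" and p: "p \<in> carrier A" "q \<in> carrier A" and w: "w \<in> Z" "v \<in> Z"
  shows "\<lbrace>i w \<otimes> p,i v \<otimes> q\<rbrace>\<^bsub>twist S\<^esub> =
    i (bracket_factor (pr p) (pr q) w v \<otimes>\<^bsub>I\<^esub> snd S (pr p) (pr q)) \<otimes> \<lbrace>p,q\<rbrace>"
proof -
  have "\<lbrace>i w \<otimes> p,i v \<otimes> q\<rbrace>\<^bsub>twist S\<^esub> =
      i (snd S (pr p) (pr q)) \<otimes> (i (bracket_factor (pr p) (pr q) w v) \<otimes> \<lbrace>p,q\<rbrace>)"
    using p w by (simp add: bracket_Z_mult del: i_mult)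
  then show ?thesis
    using p w two_cocycle_closed [OF coc] by (simp add: Z_left_collect del: i_mult)
qed

lemma restrict_terms_simps [simp]:
  "w \<in> Z \<Longrightarrow> sigma (restrict_terms \<chi> Z) x w = sigma \<chi> x w"
  "w \<in> Z \<Longrightarrow> tau (restrict_terms \<chi> Z) x w = tau \<chi> x w"
  "w \<in> Z \<Longrightarrow> nu (restrict_terms \<chi> Z) x w = nu \<chi> x w"
  by (simp_all add: restrict_terms_def)

lemma cocycle_mla_simps:
  "carrier (cocycle_mla S) = Z \<times> carrier Q"
  "\<one>\<^bsub>cocycle_mla S\<^esub> = (\<one>\<^bsub>I\<^esub>, \<one>\<^bsub>Q\<^esub>)"
  by (simp_all add: cocycle_algebra_def split: prod.splits)

lemma cocycle_mla_mult:
  assumes "a \<in> Z" "b \<in> Z"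
  shows "(a, x) \<otimes>\<^bsub>cocycle_mla S\<^esub> (b, y) = (a \<otimes>\<^bsub>I\<^esub> sigma \<chi> x b \<otimes>\<^bsub>I\<^esub> fst S x y, x \<otimes>\<^bsub>Q\<^esub> y)"
  using assms by (simp add: cocycle_algebra_def split: prod.splits)

lemma cocycle_mla_bracket:
  assumes S: "two_cocycle Q B S" and "a \<in> Z" "b \<in> Z" "x \<in> carrier Q" "y \<in> carrier Q"
  shows "\<lbrace>(a, x),(b, y)\<rbrace>\<^bsub>cocycle_mla S\<^esub> =
    (bracket_factor x y a b \<otimes>\<^bsub>I\<^esub> snd S x y, \<lbrace>x,y\<rbrace>\<^bsub>Q\<^esub>)"
proof -
  have [simp]: "snd S x y \<in> Z" using two_cocycle_closed assms by blast
  have "\<lbrace>(a, x),(b, y)\<rbrace>\<^bsub>cocycle_mla S\<^esub> = (a \<otimes>\<^bsub>I\<^esub> b \<otimes>\<^bsub>I\<^esub> tau \<chi> x b \<otimes>\<^bsub>I\<^esub> snd S x y \<otimes>\<^bsub>I\<^esub>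
      sigma \<chi> \<lbrace>x,y\<rbrace>\<^bsub>Q\<^esub> (nu \<chi> y a \<otimes>\<^bsub>I\<^esub> inv\<^bsub>I\<^esub> a \<otimes>\<^bsub>I\<^esub> inv\<^bsub>I\<^esub> b), \<lbrace>x,y\<rbrace>\<^bsub>Q\<^esub>)"
    using assms by (simp add: cocycle_algebra_def split: prod.splits)
  then show ?thesis
    using assms
      I.alg_center_comm [of "snd S x y"
        "sigma \<chi> \<lbrace>x,y\<rbrace>\<^bsub>Q\<^esub> (nu \<chi> y a \<otimes>\<^bsub>I\<^esub> inv\<^bsub>I\<^esub> a \<otimes>\<^bsub>I\<^esub> inv\<^bsub>I\<^esub> b)"]
    by (simp add: bracket_factor_def I.m_assoc)
qed

text \<open>
  The map \<open>(p, \<langle>w, x\<rangle>) \<mapsto> w p\<close> from the fibre product of the extension with the cocycle algebra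
  onto the twisted algebra preserves the operations.
\<close>

lemma twist_mla:
  assumes S: "S \<in> cocycles"
  shows "multiplicative_lie_algebra (twist S)"
proof -
  let ?C = "cocycle_mla S"
  let ?P = "mla_prod A ?C"
  have coc: "two_cocycle Q B S" and C: "multiplicative_lie_algebra ?C"
    using S by (auto simp: compatible_cocycles_def)
  note closed [simp] = two_cocycle_closed [OF coc] and
    C_simps = cocycle_mla_simps cocycle_mla_mult cocycle_mla_bracket [OF coc]
  interpret C: multiplicative_lie_algebra ?C by (rule C)
  have P: "multiplicative_lie_algebra ?P"
    by (rule mla_prod_mla) (unfold_locales)
  interpret P: multiplicative_lie_algebra ?P by (rule P)
  define R where "R = {(p, (w, x)). p \<in> carrier A \<and> w \<in> Z \<and> x = pr p}"
  have "subgroup R ?P"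
  proof (rule P.subgroupI)
    show "R \<subseteq> carrier ?P" by (auto simp: R_def C_simps)
    have "(\<one>, (\<one>\<^bsub>I\<^esub>, \<one>\<^bsub>Q\<^esub>)) \<in> R" by (simp add: R_def)
    then show "R \<noteq> {}" by blast
  next
    fix r assume "r \<in> R"
    then obtain p w where r: "r = (p, (w, pr p))" "p \<in> carrier A" "w \<in> Z" by (auto simp: R_def)
    have wC: "(w, pr p) \<in> carrier ?C" using r by (simp add: C_simps)
    obtain v y where vy: "inv\<^bsub>?C\<^esub> (w, pr p) = (v, y)" by (cases "inv\<^bsub>?C\<^esub> (w, pr p)")
    have vyC: "v \<in> Z" "y \<in> carrier Q" using C.inv_closed [OF wC] by (simp_all add: vy C_simps)
    have "(v, y) \<otimes>\<^bsub>?C\<^esub> (w, pr p) = (\<one>\<^bsub>I\<^esub>, \<one>\<^bsub>Q\<^esub>)"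
      using C.l_inv [OF wC] by (simp add: vy C_simps)
    then have "y \<otimes>\<^bsub>Q\<^esub> pr p = \<one>\<^bsub>Q\<^esub>" using r vyC by (simp add: C_simps)
    then have "y = pr (inv p)" using r vyC Q.inv_equality [of y "pr p"] by simp
    then show "inv\<^bsub>?P\<^esub> r \<in> R"
      using r vyC wC inv_mla_prod [OF multiplicative_lie_algebra_axioms C r(2) wC]
      by (simp add: R_def vy)
  next
    fix r s assume "r \<in> R" "s \<in> R"
    then show "r \<otimes>\<^bsub>?P\<^esub> s \<in> R" by (auto simp: R_def C_simps)
  qed
  moreover have "\<lbrace>r,s\<rbrace>\<^bsub>?P\<^esub> \<in> R" if "r \<in> R" "s \<in> R" for r s
    using that by (auto simp: R_def C_simps)
  ultimately have sub: "mla_subalgebra R ?P" by (simp add: mla_subalgebra_def)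
  define f :: "'e \<times> 'i \<times> 'q \<Rightarrow> 'e" where "f = (\<lambda>(p, (w, x)). i w \<otimes> p)"
  have f: "f (p, (w, x)) = i w \<otimes> p" for p w x by (simp add: f_def)
  show ?thesis
  proof (rule image_mla [OF P.subalgebra_mla [OF sub], of f])
    show "f ` carrier (?P\<lparr>carrier := R\<rparr>) = carrier (twist S)"
    proof
      show "carrier (twist S) \<subseteq> f ` carrier (?P\<lparr>carrier := R\<rparr>)"
        by (auto simp: R_def f intro!: image_eqI [of _ f "(p, (\<one>\<^bsub>I\<^esub>, pr p))" for p])
    qed (auto simp: R_def f)
    show "f \<one>\<^bsub>?P\<lparr>carrier := R\<rparr>\<^esub> = \<one>\<^bsub>twist S\<^esub>" by (simp add: C_simps f)
  next
    fix r s assume "r \<in> carrier (?P\<lparr>carrier := R\<rparr>)" "s \<in> carrier (?P\<lparr>carrier := R\<rparr>)"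
    then obtain p w q v where r: "r = (p, (w, pr p))" "p \<in> carrier A" "w \<in> Z"
      and s: "s = (q, (v, pr q))" "q \<in> carrier A" "v \<in> Z" by (auto simp: R_def)
    show "f r \<otimes>\<^bsub>twist S\<^esub> f s = f (r \<otimes>\<^bsub>?P\<lparr>carrier := R\<rparr>\<^esub> s)"
      using r s by (simp add: f C_simps twist_mult_Z [OF coc] del: i_mult twist_simps)
    show "\<lbrace>f r,f s\<rbrace>\<^bsub>twist S\<^esub> = f \<lbrace>r,s\<rbrace>\<^bsub>?P\<lparr>carrier := R\<rparr>\<^esub>"
      using r s by (simp add: f C_simps twist_bracket_Z [OF coc] del: i_mult twist_simps)
  qed
qed

text \<open>
  Conversely, the cocycle algebra is recovered from the pairs of elements of the twisted and the
  given algebra that differ by a central element \<open>w\<close>: send \<open>(w p, p)\<close> to \<open>\<langle>w, \<pi>(p)\<rangle>\<close>.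
\<close>

lemma cocycle_of_twist_mla:
  assumes coc: "two_cocycle Q B S" and T: "multiplicative_lie_algebra (twist S)"
  shows "S \<in> cocycles"
proof -
  let ?C = "cocycle_mla S"
  let ?P = "mla_prod (twist S) A"
  note closed [simp] = two_cocycle_closed [OF coc] and
    C_simps = cocycle_mla_simps cocycle_mla_mult cocycle_mla_bracket [OF coc]
  interpret T: multiplicative_lie_algebra "twist S" by (rule T)
  have P: "multiplicative_lie_algebra ?P"
    by (rule mla_prod_mla) (unfold_locales)
  interpret P: multiplicative_lie_algebra ?P by (rule P)
  define R where "R = {(i w \<otimes> p, p) |w p. w \<in> Z \<and> p \<in> carrier A}"
  have R_mult: "(i w \<otimes> p, p) \<otimes>\<^bsub>?P\<^esub> (i v \<otimes> q, q) =
      (i (w \<otimes>\<^bsub>I\<^esub> sigma \<chi> (pr p) v \<otimes>\<^bsub>I\<^esub> fst S (pr p) (pr q)) \<otimes> (p \<otimes> q), p \<otimes> q)"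
    if "w \<in> Z" "v \<in> Z" "p \<in> carrier A" "q \<in> carrier A" for w v p q
    using that by (simp add: twist_mult_Z [OF coc] del: i_mult twist_simps)
  have R_bracket: "\<lbrace>(i w \<otimes> p, p),(i v \<otimes> q, q)\<rbrace>\<^bsub>?P\<^esub> =
      (i (bracket_factor (pr p) (pr q) w v \<otimes>\<^bsub>I\<^esub> snd S (pr p) (pr q)) \<otimes> \<lbrace>p,q\<rbrace>, \<lbrace>p,q\<rbrace>)"
    if "w \<in> Z" "v \<in> Z" "p \<in> carrier A" "q \<in> carrier A" for w v p q
    using that by (simp add: twist_bracket_Z [OF coc] del: i_mult twist_simps)
  have R_I: "(i w \<otimes> p, p) \<in> R" if "w \<in> Z" "p \<in> carrier A" for w p
    using that by (auto simp: R_def)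
  have R_E: "\<exists>w p. r = (i w \<otimes> p, p) \<and> w \<in> Z \<and> p \<in> carrier A" if "r \<in> R" for r
    using that by (auto simp: R_def)
  have "subgroup R ?P"
  proof (rule P.subgroupI)
    show "R \<subseteq> carrier ?P" by (auto simp: R_def)
    show "R \<noteq> {}" using R_I [of "\<one>\<^bsub>I\<^esub>" \<one>] by auto
  next
    fix r assume "r \<in> R"
    then obtain p w where r: "r = (i w \<otimes> p, p)" "p \<in> carrier A" "w \<in> Z" using R_E by blast
    define q where "q = inv\<^bsub>twist S\<^esub> (i w \<otimes> p)"
    define c where "c = fst S (pr (i w \<otimes> p)) (pr q)"
    have q: "q \<in> carrier A" using T.inv_closed [of "i w \<otimes> p"] r by (simp add: q_def)
    have c: "c \<in> Z" using q r by (simp add: c_def)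
    have "i c \<otimes> (i w \<otimes> p \<otimes> q) = \<one>"
      using T.r_inv [of "i w \<otimes> p"] r by (simp add: c_def q_def)
    then have "inv q = i c \<otimes> (i w \<otimes> p)"
      using r q c by (intro inv_equality) (simp_all add: m_assoc)
    then have "q = inv (i c \<otimes> (i w \<otimes> p))" using q inv_inv [of q] by simp
    also have "\<dots> = inv p \<otimes> i (inv\<^bsub>I\<^esub> w \<otimes>\<^bsub>I\<^esub> inv\<^bsub>I\<^esub> c)"
      using r c by (simp add: inv_mult_group m_assoc)
    also have "\<dots> = i (sigma \<chi> (pr (inv p)) (inv\<^bsub>I\<^esub> w \<otimes>\<^bsub>I\<^esub> inv\<^bsub>I\<^esub> c)) \<otimes> inv p"
      using r c by (intro mult_Z) simp_all
    finally have "q = i (sigma \<chi> (pr (inv p)) (inv\<^bsub>I\<^esub> w \<otimes>\<^bsub>I\<^esub> inv\<^bsub>I\<^esub> c)) \<otimes> inv p" .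
    moreover have "inv\<^bsub>?P\<^esub> r = (q, inv p)"
      using r inv_mla_prod [OF T multiplicative_lie_algebra_axioms] by (simp add: q_def)
    ultimately show "inv\<^bsub>?P\<^esub> r \<in> R" using r c by (auto intro!: R_I)
  next
    fix r s assume "r \<in> R" "s \<in> R"
    then show "r \<otimes>\<^bsub>?P\<^esub> s \<in> R"
      by (auto dest!: R_E simp: R_mult simp del: mla_prod_simps i_mult intro!: R_I)
  qed
  moreover have "\<lbrace>r,s\<rbrace>\<^bsub>?P\<^esub> \<in> R" if "r \<in> R" "s \<in> R" for r s
    using that by (auto dest!: R_E simp: R_bracket simp del: mla_prod_simps i_mult intro!: R_I)
  ultimately have sub: "mla_subalgebra R ?P" by (simp add: mla_subalgebra_def)
  define f where "f = (\<lambda>(p', p). (inv_into (carrier I) i (p' \<otimes> inv p), pr p))"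
  have f: "f (i w \<otimes> p, p) = (w, pr p)" if "w \<in> Z" "p \<in> carrier A" for w p
    using that i_inj by (simp add: f_def m_assoc inv_into_f_f)
  have "multiplicative_lie_algebra ?C"
  proof (rule image_mla [OF P.subalgebra_mla [OF sub], of f])
    show "f ` carrier (?P\<lparr>carrier := R\<rparr>) = carrier ?C"
    proof
      show "f ` carrier (?P\<lparr>carrier := R\<rparr>) \<subseteq> carrier ?C"
        by (auto dest!: R_E simp: f C_simps)
      show "carrier ?C \<subseteq> f ` carrier (?P\<lparr>carrier := R\<rparr>)"
      proof
        fix c assume "c \<in> carrier ?C"
        then obtain w x where c: "c = (w, x)" "w \<in> Z" "x \<in> carrier Q" by (auto simp: C_simps)
        show "c \<in> f ` carrier (?P\<lparr>carrier := R\<rparr>)"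
          by (rule image_eqI [of _ f "(i w \<otimes> l x, l x)"]) (use c in \<open>simp_all add: f R_I\<close>)
      qed
    qed
    show "f \<one>\<^bsub>?P\<lparr>carrier := R\<rparr>\<^esub> = \<one>\<^bsub>?C\<^esub>"
      using f [of "\<one>\<^bsub>I\<^esub>" \<one>] by (simp add: C_simps)
  next
    fix r s assume "r \<in> carrier (?P\<lparr>carrier := R\<rparr>)" "s \<in> carrier (?P\<lparr>carrier := R\<rparr>)"
    then obtain p w q v where r: "r = (i w \<otimes> p, p)" "p \<in> carrier A" "w \<in> Z"
      and s: "s = (i v \<otimes> q, q)" "q \<in> carrier A" "v \<in> Z" by (auto dest!: R_E)
    have "r \<otimes>\<^bsub>?P\<lparr>carrier := R\<rparr>\<^esub> s = r \<otimes>\<^bsub>?P\<^esub> s" by simp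
    then show "f r \<otimes>\<^bsub>?C\<^esub> f s = f (r \<otimes>\<^bsub>?P\<lparr>carrier := R\<rparr>\<^esub> s)"
      using r s by (simp add: f C_simps R_mult del: mla_prod_simps i_mult)
    have "\<lbrace>r,s\<rbrace>\<^bsub>?P\<lparr>carrier := R\<rparr>\<^esub> = \<lbrace>r,s\<rbrace>\<^bsub>?P\<^esub>" by simp
    then show "\<lbrace>f r,f s\<rbrace>\<^bsub>?C\<^esub> = f \<lbrace>r,s\<rbrace>\<^bsub>?P\<lparr>carrier := R\<rparr>\<^esub>"
      using r s by (simp add: f C_simps R_bracket del: mla_prod_simps i_mult)
  qed
  then show ?thesis using coc by (simp add: compatible_cocycles_def)
qed

end

section \<open>Equivalence of extensions\<close>

lemma mla_isoI:
  assumes "bij_betw f (carrier L) (carrier M)"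
    and "\<And>x y. \<lbrakk>x \<in> carrier L; y \<in> carrier L\<rbrakk> \<Longrightarrow> f (x \<otimes>\<^bsub>L\<^esub> y) = f x \<otimes>\<^bsub>M\<^esub> f y"
    and "\<And>x y. \<lbrakk>x \<in> carrier L; y \<in> carrier L\<rbrakk> \<Longrightarrow> f \<lbrace>x,y\<rbrace>\<^bsub>L\<^esub> = \<lbrace>f x,f y\<rbrace>\<^bsub>M\<^esub>"
  shows "f \<in> mla_iso L M"
  using assms by (auto simp: mla_iso_def mla_hom_def hom_def dest: bij_betwE)

lemma mla_isoD:
  assumes "f \<in> mla_iso L M"
  shows "bij_betw f (carrier L) (carrier M)"
    and "x \<in> carrier L \<Longrightarrow> f x \<in> carrier M"
    and "\<lbrakk>x \<in> carrier L; y \<in> carrier L\<rbrakk> \<Longrightarrow> f (x \<otimes>\<^bsub>L\<^esub> y) = f x \<otimes>\<^bsub>M\<^esub> f y"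
    and "\<lbrakk>x \<in> carrier L; y \<in> carrier L\<rbrakk> \<Longrightarrow> f \<lbrace>x,y\<rbrace>\<^bsub>L\<^esub> = \<lbrace>f x,f y\<rbrace>\<^bsub>M\<^esub>"
  using assms by (simp_all add: mla_iso_def mla_hom_def hom_def Pi_iff)

lemma mla_iso_comp:
  assumes "f \<in> mla_iso L M" "g \<in> mla_iso M N"
  shows "g \<circ> f \<in> mla_iso L N"
proof (rule mla_isoI)
  show "bij_betw (g \<circ> f) (carrier L) (carrier N)"
    by (rule bij_betw_trans [OF mla_isoD(1) [OF assms(1)] mla_isoD(1) [OF assms(2)]])
qed (use assms in \<open>simp_all add: mla_isoD\<close>)

lemma mla_iso_inv:
  assumes L: "multiplicative_lie_algebra L" and f: "f \<in> mla_iso L M"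
  shows "inv_into (carrier L) f \<in> mla_iso M L"
proof (rule mla_isoI)
  interpret multiplicative_lie_algebra L by (rule L)
  let ?g = "inv_into (carrier L) f"
  show bij: "bij_betw ?g (carrier M) (carrier L)"
    using mla_isoD(1) [OF f] by (rule bij_betw_inv_into)
  have inj: "inj_on f (carrier L)" using mla_isoD(1) [OF f] by (simp add: bij_betw_def)
  fix a b assume "a \<in> carrier M" "b \<in> carrier M"
  moreover have "carrier M = f ` carrier L" using mla_isoD(1) [OF f] by (simp add: bij_betw_def)
  ultimately obtain x y where xy: "x \<in> carrier L" "a = f x" "y \<in> carrier L" "b = f y" by blast
  show "?g (a \<otimes>\<^bsub>M\<^esub> b) = ?g a \<otimes>\<^bsub>L\<^esub> ?g b"
    using xy inj by (simp add: inv_into_f_f flip: mla_isoD(3) [OF f])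
  show "?g \<lbrace>a,b\<rbrace>\<^bsub>M\<^esub> = \<lbrace>?g a,?g b\<rbrace>\<^bsub>L\<^esub>"
    using xy inj by (simp add: inv_into_f_f flip: mla_isoD(4) [OF f])
qed

lemma equiv_ext_rel:
  fixes Q :: "('q, 'm) mult_lie_scheme" and I :: "('i, 'n) mult_lie_scheme"
  shows "equiv {E :: ('i, 'e, 'q) extension. is_extension Q I E} (ext_rel Q I)"
proof (rule equivI)
  show "ext_rel Q I \<subseteq>
      {E :: ('i, 'e, 'q) extension. is_extension Q I E} \<times> {E. is_extension Q I E}"
    by (auto simp: ext_rel_def)
  show "refl_on {E :: ('i, 'e, 'q) extension. is_extension Q I E} (ext_rel Q I)"
  proof (rule refl_onI)
    fix E :: "('i, 'e, 'q) extension" assume "E \<in> {E. is_extension Q I E}"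
    moreover have "id \<in> mla_iso (total E) (total E)" by (rule mla_isoI) simp_all
    ultimately show "(E, E) \<in> ext_rel Q I"
      unfolding ext_rel_def by (auto intro!: bexI [of _ id])
  qed
  show "sym (ext_rel Q I :: ('i, 'e, 'q) extension rel)"
  proof (rule symI)
    fix E F :: "('i, 'e, 'q) extension" assume "(E, F) \<in> ext_rel Q I"
    then obtain f where E: "is_extension Q I E" and F: "is_extension Q I F"
      and f: "f \<in> mla_iso (total E) (total F)" "\<forall>a\<in>carrier I. f (incl E a) = incl F a"
        "\<forall>p\<in>carrier (total E). proj F (f p) = proj E p" by (auto simp: ext_rel_def)
    let ?g = "inv_into (carrier (total E)) f"
    have inj: "inj_on f (carrier (total E))" and im: "f ` carrier (total E) = carrier (total F)"
      using mla_isoD(1) [OF f(1)] by (simp_all add: bij_betw_def)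
    have "incl E a \<in> carrier (total E)" if "a \<in> carrier I" for a
      using E that by (auto simp: is_extension_def mla_hom_def hom_def)
    then have "?g (incl F a) = incl E a" if "a \<in> carrier I" for a
      using inj f(2) that by (metis inv_into_f_f)
    moreover have "proj E (?g p) = proj F p" if "p \<in> carrier (total F)" for p
      using that f(3) by (metis f_inv_into_f im inv_into_into)
    moreover have "?g \<in> mla_iso (total F) (total E)"
      using E f(1) by (intro mla_iso_inv) (auto simp: is_extension_def)
    ultimately show "(F, E) \<in> ext_rel Q I" using E F by (auto simp: ext_rel_def)
  qed
  show "trans (ext_rel Q I :: ('i, 'e, 'q) extension rel)"
  proof (rule transI)
    fix E F G :: "('i, 'e, 'q) extension"
    assume "(E, F) \<in> ext_rel Q I" "(F, G) \<in> ext_rel Q I"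
    then obtain f g where EFG: "is_extension Q I E" "is_extension Q I G"
      and f: "f \<in> mla_iso (total E) (total F)" "\<forall>a\<in>carrier I. f (incl E a) = incl F a"
        "\<forall>p\<in>carrier (total E). proj F (f p) = proj E p"
      and g: "g \<in> mla_iso (total F) (total G)" "\<forall>a\<in>carrier I. g (incl F a) = incl G a"
        "\<forall>p\<in>carrier (total F). proj G (g p) = proj F p" by (auto simp: ext_rel_def)
    then show "(E, G) \<in> ext_rel Q I"
      using mla_iso_comp [OF f(1) g(1)] mla_isoD(2) [OF f(1)]
      by (auto simp: ext_rel_def intro!: bexI [of _ "g \<circ> f"])
  qed
qed

lemma bij_betw_quotients:
  assumes s: "equiv E s" and X: "X \<subseteq> E"
    and r: "\<And>x y. (x, y) \<in> r \<longleftrightarrow> x \<in> A \<and> y \<in> A \<and> (g x, g y) \<in> s"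
    and g: "\<And>x. x \<in> A \<Longrightarrow> g x \<in> X"
    and onto: "\<And>e. e \<in> X \<Longrightarrow> \<exists>x\<in>A. (g x, e) \<in> s"
  shows "bij_betw (\<lambda>c. s `` (g ` c)) (A // r) (X // s)"
proof -
  have sym: "(b, a) \<in> s" if "(a, b) \<in> s" for a b using s that by (auto elim: equivE dest: symD)
  have trans: "(a, c) \<in> s" if "(a, b) \<in> s" "(b, c) \<in> s" for a b c
    using s that by (auto elim: equivE dest: transD)
  have refl: "(g x, g x) \<in> s" if "x \<in> A" for x
    using s X g [OF that] by (auto elim: equivE dest: refl_onD)
  have class_eq: "s `` (g ` (r `` {x})) = s `` {g x}" if "x \<in> A" for x
    using that refl [OF that] by (auto simp: r intro: trans)
  have eq_iff: "s `` {g x} = s `` {g y} \<longleftrightarrow> r `` {x} = r `` {y}" if "x \<in> A" "y \<in> A" for x y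
  proof
    assume "s `` {g x} = s `` {g y}"
    then have "(g x, g y) \<in> s" using refl [OF that(2)] by blast
    then show "r `` {x} = r `` {y}" using that by (auto simp: r) (blast intro: trans sym)+
  next
    assume "r `` {x} = r `` {y}"
    moreover have "y \<in> r `` {y}" using refl that by (simp add: r)
    ultimately have "(g x, g y) \<in> s" by (auto simp: r)
    then show "s `` {g x} = s `` {g y}" by (blast intro: trans sym)
  qed
  show ?thesis
  proof (rule bij_betw_imageI)
    show "inj_on (\<lambda>c. s `` (g ` c)) (A // r)"
      by (rule inj_onI) (auto simp: quotient_def class_eq eq_iff)
    show "(\<lambda>c. s `` (g ` c)) ` (A // r) = X // s"
    proof
      show "(\<lambda>c. s `` (g ` c)) ` (A // r) \<subseteq> X // s"
        using g by (auto simp: quotient_def class_eq intro!: bexI [of _ "g x" for x])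
      show "X // s \<subseteq> (\<lambda>c. s `` (g ` c)) ` (A // r)"
      proof
        fix c assume "c \<in> X // s"
        then obtain e where e: "e \<in> X" "c = s `` {e}" by (auto simp: quotient_def)
        obtain x where x: "x \<in> A" "(g x, e) \<in> s" using onto e by blast
        then have "c = s `` {g x}" using e by (blast intro: trans sym)
        then show "c \<in> (\<lambda>c. s `` (g ` c)) ` (A // r)"
          using x by (intro image_eqI [of _ _ "r `` {x}"]) (simp_all add: class_eq quotientI)
      qed
    qed
  qed
qed

section \<open>Cohomologous cocycles and equivalent twists\<close>

context realization
begin

definition twist_ext :: "('q, 'i) cochain \<Rightarrow> ('i, 'e, 'q) extension" where
  "twist_ext S = \<lparr>total = twist S, incl = i, proj = pr\<rparr>"

lemma twist_ext_simps [simp]: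
  "total (twist_ext S) = twist S" "incl (twist_ext S) = i" "proj (twist_ext S) = pr"
  by (simp_all add: twist_ext_def)

lemma terms_one:
  assumes "a \<in> carrier I"
  shows "sigma \<chi> \<one>\<^bsub>Q\<^esub> a = a" "tau \<chi> \<one>\<^bsub>Q\<^esub> a = \<one>\<^bsub>I\<^esub>" "nu \<chi> \<one>\<^bsub>Q\<^esub> a = \<one>\<^bsub>I\<^esub>"
proof -
  have "i (sigma \<chi> \<one>\<^bsub>Q\<^esub> a) = i a" using conjugate_l [of "\<one>\<^bsub>Q\<^esub>" a] assms by (simp add: l_one)
  then show "sigma \<chi> \<one>\<^bsub>Q\<^esub> a = a" using assms by simp
  have "i (tau \<chi> \<one>\<^bsub>Q\<^esub> a) = i \<one>\<^bsub>I\<^esub>" using bracket_l_left [of "\<one>\<^bsub>Q\<^esub>" a] assms by (simp add: l_one)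
  then show "tau \<chi> \<one>\<^bsub>Q\<^esub> a = \<one>\<^bsub>I\<^esub>" using assms by (simp del: i_one)
  have "i (nu \<chi> \<one>\<^bsub>Q\<^esub> a) = i \<one>\<^bsub>I\<^esub>" using bracket_l_right [of "\<one>\<^bsub>Q\<^esub>" a] assms by (simp add: l_one)
  then show "nu \<chi> \<one>\<^bsub>Q\<^esub> a = \<one>\<^bsub>I\<^esub>" using assms by (simp del: i_one)
qed

lemma twist_kernel_simps:
  assumes coc: "two_cocycle Q B S" and "p \<in> carrier A" "a \<in> carrier I"
  shows "p \<otimes>\<^bsub>twist S\<^esub> i a = p \<otimes> i a" "i a \<otimes>\<^bsub>twist S\<^esub> p = i a \<otimes> p"
    and "\<lbrace>p,i a\<rbrace>\<^bsub>twist S\<^esub> = \<lbrace>p,i a\<rbrace>" "\<lbrace>i a,p\<rbrace>\<^bsub>twist S\<^esub> = \<lbrace>i a,p\<rbrace>"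
  using assms by (simp_all add: two_cocycle_one [OF coc])

lemma twist_realization:
  assumes S: "S \<in> cocycles"
  shows "realization Q I (twist S) i pr \<chi> l"
proof -
  have coc: "two_cocycle Q B S" using S by (simp add: compatible_cocycles_def)
  interpret T: multiplicative_lie_algebra "twist S" by (rule twist_mla [OF S])
  note tk = twist_kernel_simps [OF coc]
  note closed [simp] = two_cocycle_closed [OF coc]
  show ?thesis
  proof
    fix x a assume xa: "x \<in> carrier Q" "a \<in> carrier I"
    have "l x \<otimes> i a = i (sigma \<chi> x a) \<otimes> l x"
      using xa by (simp flip: conjugate_l add: conjugate_def word_simps)
    then show "conjugate (twist S) (i a) (l x) = i (sigma \<chi> x a)"
      using xa by (intro T.conjugateI) (simp_all add: tk del: twist_simps(2))
    show "\<lbrace>l x,i a\<rbrace>\<^bsub>twist S\<^esub> = i (tau \<chi> x a)" "\<lbrace>i a,l x\<rbrace>\<^bsub>twist S\<^esub> = i (nu \<chi> x a)"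
      using xa by (simp_all add: tk bracket_l_left bracket_l_right del: twist_simps(4))
  next
    fix a b assume ab: "a \<in> carrier I" "b \<in> carrier I"
    then show "i (a \<otimes>\<^bsub>I\<^esub> b) = i a \<otimes>\<^bsub>twist S\<^esub> i b" "i \<lbrace>a,b\<rbrace>\<^bsub>I\<^esub> = \<lbrace>i a,i b\<rbrace>\<^bsub>twist S\<^esub>"
      by (simp_all add: tk del: twist_simps(2,4))
  next
    show "inj_on i (carrier I)" by (rule i_inj)
  qed (auto simp: l_one kernel_pr)
qed

lemma realization_is_extension:
  assumes "total E = A" "incl E = i" "proj E = pr"
  shows "is_extension Q I E"
proof -
  have "x \<in> pr ` carrier A" if "x \<in> carrier Q" for x
    using that by (intro image_eqI [of _ pr "l x"]) simp_all
  then have "pr ` carrier A = carrier Q" by auto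
  moreover have "i ` carrier I = kernel A Q pr"
    using kernel_pr by (auto simp: kernel_def)
  ultimately show ?thesis
    using assms i_inj multiplicative_lie_algebra_axioms
    by (auto simp: is_extension_def mla_hom_def hom_def)
qed

lemma realization_realizes_class:
  assumes E: "total E = A" "incl E = i" "proj E = pr"
  shows "realizes_class Q I \<chi> E"
proof -
  have "is_section Q E l" using E by (simp add: is_section_def l_one)
  moreover have "equiv_terms Q I (section_terms I E l) \<chi>"
    unfolding equiv_terms_def section_terms_def Let_def E
    by (intro bexI [of _ "\<lambda>_. \<one>\<^bsub>I\<^esub>"])
      (simp_all add: i_inj inv_into_f_f bracket_l_left bracket_l_right conjugate_l
         flip: conjugate_def)
  ultimately show ?thesis by (auto simp: realizes_class_def)
qed

text \<open>The coboundary condition on \<open>S - S'\<close>, with all inverses cleared.\<close>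

definition cobounds :: "('q \<Rightarrow> 'i) \<Rightarrow> ('q, 'i) cochain \<Rightarrow> ('q, 'i) cochain \<Rightarrow> bool" where
  "cobounds h S S' \<longleftrightarrow> (\<forall>x\<in>carrier Q. \<forall>y\<in>carrier Q.
     fst S x y \<otimes>\<^bsub>I\<^esub> h (x \<otimes>\<^bsub>Q\<^esub> y) = h x \<otimes>\<^bsub>I\<^esub> sigma \<chi> x (h y) \<otimes>\<^bsub>I\<^esub> fst S' x y \<and>
     snd S x y \<otimes>\<^bsub>I\<^esub> h \<lbrace>x,y\<rbrace>\<^bsub>Q\<^esub> = bracket_factor x y (h x) (h y) \<otimes>\<^bsub>I\<^esub> snd S' x y)"

lemma two_coboundary_diff_iff:
  assumes S: "two_cocycle Q B S" "two_cocycle Q B S'"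
  shows "two_coboundary Q B (restrict_terms \<chi> Z) (cochain_diff B S S') \<longleftrightarrow>
    (\<exists>h\<in>carrier Q \<rightarrow> Z. cobounds h S S')"
proof -
  interpret B: comm_group B by (rule I.comm_group_center)
  note closed = two_cocycle_closed [OF S(1)] two_cocycle_closed [OF S(2)]
  have quotient: "a \<otimes>\<^bsub>I\<^esub> inv\<^bsub>I\<^esub> b = c \<otimes>\<^bsub>I\<^esub> inv\<^bsub>I\<^esub> d \<longleftrightarrow> a \<otimes>\<^bsub>I\<^esub> d = c \<otimes>\<^bsub>I\<^esub> b"
    if "a \<in> Z" "b \<in> Z" "c \<in> Z" "d \<in> Z" for a b c d
    using B.quotient_eq_iff [of a b c d] that by simp
  have rotate: "t \<otimes>\<^bsub>I\<^esub> a \<otimes>\<^bsub>I\<^esub> b \<otimes>\<^bsub>I\<^esub> s = a \<otimes>\<^bsub>I\<^esub> b \<otimes>\<^bsub>I\<^esub> t \<otimes>\<^bsub>I\<^esub> s" if "t \<in> Z" "a \<in> Z" "b \<in> Z" "s \<in> Z" for t a b s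
    using that I.alg_center_comm [of t "a \<otimes>\<^bsub>I\<^esub> b"] by (simp add: I.m_assoc)
  have iff: "(fst S x y \<otimes>\<^bsub>I\<^esub> inv\<^bsub>I\<^esub> fst S' x y =
          h x \<otimes>\<^bsub>I\<^esub> sigma \<chi> x (h y) \<otimes>\<^bsub>I\<^esub> inv\<^bsub>I\<^esub> h (x \<otimes>\<^bsub>Q\<^esub> y)) \<longleftrightarrow>
      fst S x y \<otimes>\<^bsub>I\<^esub> h (x \<otimes>\<^bsub>Q\<^esub> y) = h x \<otimes>\<^bsub>I\<^esub> sigma \<chi> x (h y) \<otimes>\<^bsub>I\<^esub> fst S' x y"
    if h: "h \<in> carrier Q \<rightarrow> Z" and xy: "x \<in> carrier Q" "y \<in> carrier Q" for h x y
  proof -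
    have [simp]: "h z \<in> Z" if "z \<in> carrier Q" for z using h that by auto
    show ?thesis using xy by (intro quotient) (simp_all add: closed)
  qed
  have iff_f: "(snd S x y \<otimes>\<^bsub>I\<^esub> inv\<^bsub>I\<^esub> snd S' x y =
          tau \<chi> x (h y) \<otimes>\<^bsub>I\<^esub> h x \<otimes>\<^bsub>I\<^esub> h y \<otimes>\<^bsub>I\<^esub>
            sigma \<chi> \<lbrace>x,y\<rbrace>\<^bsub>Q\<^esub> (nu \<chi> y (h x) \<otimes>\<^bsub>I\<^esub> inv\<^bsub>I\<^esub> h x \<otimes>\<^bsub>I\<^esub> inv\<^bsub>I\<^esub> h y) \<otimes>\<^bsub>I\<^esub> inv\<^bsub>I\<^esub> h \<lbrace>x,y\<rbrace>\<^bsub>Q\<^esub>) \<longleftrightarrow>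
      snd S x y \<otimes>\<^bsub>I\<^esub> h \<lbrace>x,y\<rbrace>\<^bsub>Q\<^esub> = bracket_factor x y (h x) (h y) \<otimes>\<^bsub>I\<^esub> snd S' x y"
    if h: "h \<in> carrier Q \<rightarrow> Z" and xy: "x \<in> carrier Q" "y \<in> carrier Q" for h x y
  proof -
    have [simp]: "h z \<in> Z" if "z \<in> carrier Q" for z using h that by auto
    show ?thesis
      using xy by (subst rotate; (subst quotient)?) (simp_all add: closed bracket_factor_def)
  qed
  have "two_coboundary Q B (restrict_terms \<chi> Z) (cochain_diff B S S') \<longleftrightarrow>
    (\<exists>h\<in>carrier Q \<rightarrow> Z. \<forall>x\<in>carrier Q. \<forall>y\<in>carrier Q.
      fst S x y \<otimes>\<^bsub>I\<^esub> inv\<^bsub>I\<^esub> fst S' x y =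
          h x \<otimes>\<^bsub>I\<^esub> sigma \<chi> x (h y) \<otimes>\<^bsub>I\<^esub> inv\<^bsub>I\<^esub> h (x \<otimes>\<^bsub>Q\<^esub> y) \<and>
      snd S x y \<otimes>\<^bsub>I\<^esub> inv\<^bsub>I\<^esub> snd S' x y =
          tau \<chi> x (h y) \<otimes>\<^bsub>I\<^esub> h x \<otimes>\<^bsub>I\<^esub> h y \<otimes>\<^bsub>I\<^esub>
            sigma \<chi> \<lbrace>x,y\<rbrace>\<^bsub>Q\<^esub> (nu \<chi> y (h x) \<otimes>\<^bsub>I\<^esub> inv\<^bsub>I\<^esub> h x \<otimes>\<^bsub>I\<^esub> inv\<^bsub>I\<^esub> h y) \<otimes>\<^bsub>I\<^esub> inv\<^bsub>I\<^esub> h \<lbrace>x,y\<rbrace>\<^bsub>Q\<^esub>)"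
    unfolding two_coboundary_def cochain_diff_def case_prod_unfold
    by (auto simp: closed Pi_iff intro!: bex_cong ball_cong)
  also have "\<dots> \<longleftrightarrow> (\<exists>h\<in>carrier Q \<rightarrow> Z. cobounds h S S')"
    unfolding cobounds_def by (intro bex_cong ball_cong refl) (simp only: iff iff_f)
  finally show ?thesis .
qed

definition shift :: "('q \<Rightarrow> 'i) \<Rightarrow> 'e \<Rightarrow> 'e" where
  "shift h p = i (h (pr p)) \<otimes> p"

lemma shift_twist:
  assumes S: "two_cocycle Q B S" "two_cocycle Q B S'" and h: "h \<in> carrier Q \<rightarrow> Z"
    and p: "p \<in> carrier A" "q \<in> carrier A"
  shows "shift h (p \<otimes>\<^bsub>twist S\<^esub> q) = shift h p \<otimes>\<^bsub>twist S'\<^esub> shift h q \<longleftrightarrow>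
      fst S (pr p) (pr q) \<otimes>\<^bsub>I\<^esub> h (pr p \<otimes>\<^bsub>Q\<^esub> pr q) =
        h (pr p) \<otimes>\<^bsub>I\<^esub> sigma \<chi> (pr p) (h (pr q)) \<otimes>\<^bsub>I\<^esub> fst S' (pr p) (pr q)"
    and "shift h \<lbrace>p,q\<rbrace>\<^bsub>twist S\<^esub> = \<lbrace>shift h p,shift h q\<rbrace>\<^bsub>twist S'\<^esub> \<longleftrightarrow>
      snd S (pr p) (pr q) \<otimes>\<^bsub>I\<^esub> h \<lbrace>pr p,pr q\<rbrace>\<^bsub>Q\<^esub> =
        bracket_factor (pr p) (pr q) (h (pr p)) (h (pr q)) \<otimes>\<^bsub>I\<^esub> snd S' (pr p) (pr q)"
proof -
  note closed [simp] = two_cocycle_closed [OF S(1)] two_cocycle_closed [OF S(2)]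
  have h' [simp]: "h z \<in> Z" if "z \<in> carrier Q" for z using h that by auto
  define x y where "x = pr p" and "y = pr q"
  have xy [simp]: "x \<in> carrier Q" "y \<in> carrier Q" using p by (simp_all add: x_def y_def)
  have "shift h (p \<otimes>\<^bsub>twist S\<^esub> q) = i (fst S x y \<otimes>\<^bsub>I\<^esub> h (x \<otimes>\<^bsub>Q\<^esub> y)) \<otimes> (p \<otimes> q)"
    using p by (simp add: shift_def Z_left_collect del: i_mult flip: x_def y_def)
  moreover have "shift h p \<otimes>\<^bsub>twist S'\<^esub> shift h q =
      i (h x \<otimes>\<^bsub>I\<^esub> sigma \<chi> x (h y) \<otimes>\<^bsub>I\<^esub> fst S' x y) \<otimes> (p \<otimes> q)"
    unfolding shift_def using p
    by (subst twist_mult_Z [OF S(2)]) (simp_all flip: x_def y_def)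
  ultimately show "shift h (p \<otimes>\<^bsub>twist S\<^esub> q) = shift h p \<otimes>\<^bsub>twist S'\<^esub> shift h q \<longleftrightarrow>
      fst S (pr p) (pr q) \<otimes>\<^bsub>I\<^esub> h (pr p \<otimes>\<^bsub>Q\<^esub> pr q) =
        h (pr p) \<otimes>\<^bsub>I\<^esub> sigma \<chi> (pr p) (h (pr q)) \<otimes>\<^bsub>I\<^esub> fst S' (pr p) (pr q)"
    using p by (simp del: i_mult twist_simps flip: x_def y_def)
  have "shift h \<lbrace>p,q\<rbrace>\<^bsub>twist S\<^esub> = i (snd S x y \<otimes>\<^bsub>I\<^esub> h \<lbrace>x,y\<rbrace>\<^bsub>Q\<^esub>) \<otimes> \<lbrace>p,q\<rbrace>"
    using p by (simp add: shift_def Z_left_collect del: i_mult flip: x_def y_def)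
  moreover have "\<lbrace>shift h p,shift h q\<rbrace>\<^bsub>twist S'\<^esub> =
      i (bracket_factor x y (h x) (h y) \<otimes>\<^bsub>I\<^esub> snd S' x y) \<otimes> \<lbrace>p,q\<rbrace>"
    unfolding shift_def using p
    by (subst twist_bracket_Z [OF S(2)]) (simp_all flip: x_def y_def)
  ultimately show "shift h \<lbrace>p,q\<rbrace>\<^bsub>twist S\<^esub> = \<lbrace>shift h p,shift h q\<rbrace>\<^bsub>twist S'\<^esub> \<longleftrightarrow>
      snd S (pr p) (pr q) \<otimes>\<^bsub>I\<^esub> h \<lbrace>pr p,pr q\<rbrace>\<^bsub>Q\<^esub> =
        bracket_factor (pr p) (pr q) (h (pr p)) (h (pr q)) \<otimes>\<^bsub>I\<^esub> snd S' (pr p) (pr q)"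
    using p by (simp del: i_mult twist_simps flip: x_def y_def)
qed

text \<open>
  The shift by \<open>h\<close> fixes the kernel since \<open>h(1) = 1\<close>: at \<open>(1,1)\<close> both cocycles are trivial, so the
  coboundary equation makes \<open>h(1)\<close> idempotent.
\<close>

lemma cobounds_equivalent:
  assumes S: "S \<in> cocycles" "S' \<in> cocycles" and h: "h \<in> carrier Q \<rightarrow> Z" and hS: "cobounds h S S'"
  shows "(twist_ext S, twist_ext S') \<in> ext_rel Q I"
proof -
  have coc: "two_cocycle Q B S" "two_cocycle Q B S'"
    using S by (auto simp: compatible_cocycles_def)
  have h' [simp]: "h z \<in> Z" if "z \<in> carrier Q" for z using h that by auto
  have "h \<one>\<^bsub>Q\<^esub> = h \<one>\<^bsub>Q\<^esub> \<otimes>\<^bsub>I\<^esub> h \<one>\<^bsub>Q\<^esub>"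
    using hS
    by (auto simp: cobounds_def two_cocycle_one [OF coc(1)] two_cocycle_one [OF coc(2)] terms_one
        dest!: bspec [of "carrier Q" _ "\<one>\<^bsub>Q\<^esub>"])
  then have h1: "h \<one>\<^bsub>Q\<^esub> = \<one>\<^bsub>I\<^esub>" by (intro I.idempotent_is_one) simp_all
  have iso: "shift h \<in> mla_iso (twist S) (twist S')"
  proof (rule mla_isoI)
    show "bij_betw (shift h) (carrier (twist S)) (carrier (twist S'))"
      by (rule bij_betw_byWitness [where f' = "shift (\<lambda>x. inv\<^bsub>I\<^esub> h x)"])
        (auto simp: shift_def word_simps)
  next
    fix p q assume p: "p \<in> carrier (twist S)" "q \<in> carrier (twist S)"
    then have p': "p \<in> carrier A" "q \<in> carrier A" by simp_all
    show "shift h (p \<otimes>\<^bsub>twist S\<^esub> q) = shift h p \<otimes>\<^bsub>twist S'\<^esub> shift h q"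
      unfolding shift_twist(1) [OF coc h p'] using hS p' by (simp add: cobounds_def)
    show "shift h \<lbrace>p,q\<rbrace>\<^bsub>twist S\<^esub> = \<lbrace>shift h p,shift h q\<rbrace>\<^bsub>twist S'\<^esub>"
      unfolding shift_twist(2) [OF coc h p'] using hS p' by (simp add: cobounds_def)
  qed
  moreover have "is_extension Q I (twist_ext T)" if "T \<in> cocycles" for T
    using realization.realization_is_extension [OF twist_realization [OF that]] by simp
  ultimately show ?thesis
    using S by (auto simp: ext_rel_def shift_def h1 intro!: bexI [of _ "shift h"])
qed

text \<open>
  An equivalence fixes the kernel and the quotient, hence moves every element only within its
  fibre and without changing its action on the kernel: it is a shift by central elements.
\<close>

lemma equivalent_cobounds:
  assumes S: "S \<in> cocycles" "S' \<in> cocycles"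
    and eq: "(twist_ext S, twist_ext S') \<in> ext_rel Q I"
  shows "\<exists>h\<in>carrier Q \<rightarrow> Z. cobounds h S S'"
proof -
  have coc: "two_cocycle Q B S" "two_cocycle Q B S'"
    using S by (auto simp: compatible_cocycles_def)
  obtain \<phi> where \<phi>: "\<phi> \<in> mla_iso (twist S) (twist S')"
    and \<phi>_i: "\<And>a. a \<in> carrier I \<Longrightarrow> \<phi> (i a) = i a"
    and \<phi>_pr: "\<And>p. p \<in> carrier A \<Longrightarrow> pr (\<phi> p) = pr p"
    using eq by (auto simp: ext_rel_def)
  have \<phi>_closed [simp]: "\<phi> p \<in> carrier A" if "p \<in> carrier A" for p
    using mla_isoD(2) [OF \<phi>] that by simp
  note tk = twist_kernel_simps [OF coc(1)] twist_kernel_simps [OF coc(2)]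
  have \<phi>_left: "\<phi> (i a \<otimes> p) = i a \<otimes> \<phi> p" if "p \<in> carrier A" "a \<in> carrier I" for p a
    using mla_isoD(3) [OF \<phi>, of "i a" p] that by (simp add: \<phi>_i tk del: twist_simps(2))
  have \<phi>_right: "\<phi> (p \<otimes> i a) = \<phi> p \<otimes> i a" if "p \<in> carrier A" "a \<in> carrier I" for p a
    using mla_isoD(3) [OF \<phi>, of p "i a"] that by (simp add: \<phi>_i tk del: twist_simps(2))
  have \<phi>_bracket: "\<phi> \<lbrace>p,i a\<rbrace> = \<lbrace>\<phi> p,i a\<rbrace>" if "p \<in> carrier A" "a \<in> carrier I" for p a
    using mla_isoD(4) [OF \<phi>, of p "i a"] that by (simp add: \<phi>_i tk del: twist_simps(4))
  have differ: "\<exists>w\<in>Z. \<phi> p = i w \<otimes> p" if p: "p \<in> carrier A" for p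
  proof -
    have "conjugate A (i a) (\<phi> p) = conjugate A (i a) p" if a: "a \<in> carrier I" for a
    proof -
      obtain b where b: "b \<in> carrier I" "conjugate A (i a) p = i b" using conjugate_i p a by blast
      have "p \<otimes> i a = i b \<otimes> p" using a p by (simp flip: b(2) add: conjugate_def word_simps)
      then have "\<phi> p \<otimes> i a = i b \<otimes> \<phi> p" using a b p by (simp flip: \<phi>_left \<phi>_right)
      then show ?thesis using a b p by (simp add: conjugateI)
    qed
    moreover have "\<lbrace>\<phi> p,i a\<rbrace> = \<lbrace>p,i a\<rbrace>" if a: "a \<in> carrier I" for a
      using bracket_i [OF p a] \<phi>_bracket [OF p a] \<phi>_i by metis
    ultimately show ?thesis
      using alike_differ_by_Z [OF \<phi>_closed [OF p] p \<phi>_pr [OF p]] by metis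
  qed
  have "\<forall>x\<in>carrier Q. \<exists>w. w \<in> Z \<and> \<phi> (l x) = i w \<otimes> l x"
    using differ [OF l_closed] by blast
  then obtain h where h: "\<And>x. x \<in> carrier Q \<Longrightarrow> h x \<in> Z \<and> \<phi> (l x) = i (h x) \<otimes> l x"
    by metis
  then have hZ: "h \<in> carrier Q \<rightarrow> Z" by auto
  have \<phi>_shift: "\<phi> p = shift h p" if p: "p \<in> carrier A" for p
  proof -
    obtain u where u: "u \<in> carrier I" "p = i u \<otimes> l (pr p)" using over_section p by blast
    have hp: "h (pr p) \<in> Z" "\<phi> (l (pr p)) = i (h (pr p)) \<otimes> l (pr p)" using h p by auto
    have "\<phi> p = i u \<otimes> (i (h (pr p)) \<otimes> l (pr p))"
      using u p \<phi>_left [of "l (pr p)" u] hp(2) by simp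
    also have "\<dots> = i (h (pr p)) \<otimes> (i u \<otimes> l (pr p))"
      using u(1) p hp(1) Z_i_comm [of "h (pr p)" u] by (simp flip: m_assoc)
    finally show ?thesis using u(2) by (simp add: shift_def)
  qed
  have "cobounds h S S'"
    unfolding cobounds_def
  proof (intro ballI)
    fix x y assume xy: "x \<in> carrier Q" "y \<in> carrier Q"
    then have l: "l x \<in> carrier A" "l y \<in> carrier A" by simp_all
    have lT: "l x \<in> carrier (twist S)" "l y \<in> carrier (twist S)" using l by simp_all
    have c: "l x \<otimes>\<^bsub>twist S\<^esub> l y \<in> carrier A" "\<lbrace>l x,l y\<rbrace>\<^bsub>twist S\<^esub> \<in> carrier A"
      using xy two_cocycle_closed [OF coc(1) xy] by simp_all
    show "fst S x y \<otimes>\<^bsub>I\<^esub> h (x \<otimes>\<^bsub>Q\<^esub> y) = h x \<otimes>\<^bsub>I\<^esub> sigma \<chi> x (h y) \<otimes>\<^bsub>I\<^esub> fst S' x y \<and>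
      snd S x y \<otimes>\<^bsub>I\<^esub> h \<lbrace>x,y\<rbrace>\<^bsub>Q\<^esub> = bracket_factor x y (h x) (h y) \<otimes>\<^bsub>I\<^esub> snd S' x y"
      using shift_twist [OF coc hZ l] mla_isoD(3,4) [OF \<phi> lT]
      unfolding \<phi>_shift [OF l(1)] \<phi>_shift [OF l(2)] \<phi>_shift [OF c(1)] \<phi>_shift [OF c(2)]
      using xy by simp
  qed
  then show ?thesis using hZ by blast
qed

lemma cohomologous_iff:
  "(S, S') \<in> cohomologous Q B (restrict_terms \<chi> Z) \<longleftrightarrow>
    S \<in> cocycles \<and> S' \<in> cocycles \<and> (twist_ext S, twist_ext S') \<in> ext_rel Q I"
proof -
  have "(twist_ext S, twist_ext S') \<in> ext_rel Q I \<longleftrightarrow>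
      two_coboundary Q B (restrict_terms \<chi> Z) (cochain_diff B S S')"
    if "S \<in> cocycles" "S' \<in> cocycles"
  proof -
    have "two_cocycle Q B S" "two_cocycle Q B S'"
      using that by (simp_all add: compatible_cocycles_def)
    then show ?thesis
      using cobounds_equivalent [OF that] equivalent_cobounds [OF that]
      by (auto simp: two_coboundary_diff_iff)
  qed
  then show ?thesis by (auto simp: cohomologous_def)
qed

end

section \<open>Comparing two extensions that realize the same action terms\<close>

locale two_realizations =
  E: realization Q I A i pr \<chi> l + E': realization Q I A' i' pr' \<chi> l'
  for Q :: "'q mult_lie" and I :: "'i mult_lie" and A :: "'e mult_lie" and i pr \<chi> l
    and A' :: "'f mult_lie" and i' pr' l'
begin

abbreviation M where "M \<equiv> mla_prod A A'"

sublocale M: multiplicative_lie_algebra M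
  by (rule mla_prod_mla [OF E.multiplicative_lie_algebra_axioms E'.multiplicative_lie_algebra_axioms])

lemmas M_inv = inv_mla_prod [OF E.multiplicative_lie_algebra_axioms E'.multiplicative_lie_algebra_axioms]
lemmas M_conjugate =
  conjugate_mla_prod [OF E.multiplicative_lie_algebra_axioms E'.multiplicative_lie_algebra_axioms]

definition diagonal :: "('e \<times> 'f) set" where
  "diagonal = (\<lambda>u. (i u, i' u)) ` carrier I"

lemma diagonalI: "u \<in> carrier I \<Longrightarrow> (i u, i' u) \<in> diagonal"
  by (simp add: diagonal_def)

lemma diagonalE:
  assumes "r \<in> diagonal"
  obtains u where "r = (i u, i' u)" "u \<in> carrier I"
  using assms by (auto simp: diagonal_def)

lemma diagonal_closed:
  assumes "u \<in> carrier I" "v \<in> carrier I"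
  shows "(i u \<otimes>\<^bsub>A\<^esub> i v, i' u \<otimes>\<^bsub>A'\<^esub> i' v) \<in> diagonal"
    and "(inv\<^bsub>A\<^esub> (i u), inv\<^bsub>A'\<^esub> (i' u)) \<in> diagonal"
    and "(\<lbrace>i u,i v\<rbrace>\<^bsub>A\<^esub>, \<lbrace>i' u,i' v\<rbrace>\<^bsub>A'\<^esub>) \<in> diagonal"
  using diagonalI [of "u \<otimes>\<^bsub>I\<^esub> v"] diagonalI [of "inv\<^bsub>I\<^esub> u"] diagonalI [of "\<lbrace>u,v\<rbrace>\<^bsub>I\<^esub>"] assms
  by simp_all

lemma diagonal_subalgebra: "mla_subalgebra diagonal M"
proof -
  have "subgroup diagonal M"
  proof (rule M.subgroupI)
    show "diagonal \<subseteq> carrier M" by (auto simp: diagonal_def)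
    show "diagonal \<noteq> {}" using diagonalI [OF E.I.one_closed] by blast
    show "inv\<^bsub>M\<^esub> r \<in> diagonal" if "r \<in> diagonal" for r
      using that by (elim diagonalE) (simp add: M_inv diagonal_closed)
    show "r \<otimes>\<^bsub>M\<^esub> s \<in> diagonal" if "r \<in> diagonal" "s \<in> diagonal" for r s
      using that by (elim diagonalE) (simp add: diagonal_closed)
  qed
  moreover have "\<lbrace>r,s\<rbrace>\<^bsub>M\<^esub> \<in> diagonal" if "r \<in> diagonal" "s \<in> diagonal" for r s
    using that by (elim diagonalE) (simp add: diagonal_closed)
  ultimately show ?thesis by (simp add: mla_subalgebra_def)
qed

lemma diagonal_unique: "\<lbrakk>(i u, q) \<in> diagonal; u \<in> carrier I\<rbrakk> \<Longrightarrow> q = i' u"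
  by (auto simp: diagonal_def)

text \<open>
  This is where the equality of the action terms enters. For the inverses, \<open>\<sigma>\<^sub>x\<close> has to be inverted on
  both sides; the two preimages agree since \<open>\<sigma>\<^sub>x\<close> is injective.
\<close>

lemma section_in_idealizer:
  assumes x: "x \<in> carrier Q"
  shows "(l x, l' x) \<in> idealizer M diagonal"
proof (rule idealizerI)
  show "(l x, l' x) \<in> carrier M" using x by simp
  fix h assume "h \<in> diagonal"
  then obtain u where u: "h = (i u, i' u)" "u \<in> carrier I" by (auto simp: diagonal_def)
  show "conjugate M h (l x, l' x) \<in> diagonal"
    using u x by (simp add: M_conjugate E.conjugate_l E'.conjugate_l diagonalI)
  show "\<lbrace>(l x, l' x),h\<rbrace>\<^bsub>M\<^esub> \<in> diagonal"
    using u x by (simp add: E.bracket_l_left E'.bracket_l_left diagonalI)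
  obtain b where b: "b \<in> carrier I" "conjugate A (i u) (inv\<^bsub>A\<^esub> (l x)) = i b"
    using E.conjugate_i [of "inv\<^bsub>A\<^esub> (l x)" u] u x by auto
  obtain b' where b': "b' \<in> carrier I" "conjugate A' (i' u) (inv\<^bsub>A'\<^esub> (l' x)) = i' b'"
    using E'.conjugate_i [of "inv\<^bsub>A'\<^esub> (l' x)" u] u x by auto
  have "i u = conjugate A (i b) (l x)" unfolding b(2) [symmetric] using u x by simp
  then have su: "sigma \<chi> x b = u" using b x u by (simp add: E.conjugate_l)
  have "i' u = conjugate A' (i' b') (l' x)" unfolding b'(2) [symmetric] using u x by simp
  then have "sigma \<chi> x b' = u" using b' x u by (simp add: E'.conjugate_l)
  then have "conjugate A (i b') (l x) = conjugate A (i b) (l x)"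
    using su b b' x by (simp add: E.conjugate_l)
  then have "b' = b" using b b' x by (simp add: conjugate_def)
  then show "conjugate M h (inv\<^bsub>M\<^esub> (l x, l' x)) \<in> diagonal"
    using u x b b' by (simp add: M_conjugate M_inv diagonalI)
qed

lemma idealizer_closed:
  assumes "(p, q) \<in> idealizer M diagonal"
  shows "p \<in> carrier A" "q \<in> carrier A'"
  using idealizerD(1) [OF assms] by auto

text \<open>Membership of \<open>(p, q)\<close> in the idealizer of the diagonal means that \<open>q\<close> acts on \<open>I\<close> as \<open>p\<close> does.\<close>

lemma partners_differ_by_Z:
  assumes N: "(p, q) \<in> idealizer M diagonal" "(p, q') \<in> idealizer M diagonal"
    and "pr' q = pr' q'"
  obtains w where "w \<in> alg_center I" "q = i' w \<otimes>\<^bsub>A'\<^esub> q'"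
proof (rule E'.alike_differ_by_Z)
  note c [simp] = idealizer_closed [OF N(1)] idealizer_closed [OF N(2)]
  fix a assume a: "a \<in> carrier I"
  obtain b where b: "b \<in> carrier I" "conjugate A (i a) p = i b" using E.conjugate_i a c by blast
  have "(i b, conjugate A' (i' a) q) \<in> diagonal" "(i b, conjugate A' (i' a) q') \<in> diagonal"
    using idealizerD(2) [OF N(1) diagonalI [OF a]] idealizerD(2) [OF N(2) diagonalI [OF a]] b(2)
    by (simp_all add: M_conjugate)
  then show "conjugate A' (i' a) q = conjugate A' (i' a) q'"
    using diagonal_unique [OF _ b(1)] by metis
  obtain d where d: "d \<in> carrier I" "\<lbrace>p,i a\<rbrace>\<^bsub>A\<^esub> = i d" using E.bracket_i a c by blast
  have "(i d, \<lbrace>q,i' a\<rbrace>\<^bsub>A'\<^esub>) \<in> diagonal" "(i d, \<lbrace>q',i' a\<rbrace>\<^bsub>A'\<^esub>) \<in> diagonal"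
    using idealizerD(4) [OF N(1) diagonalI [OF a]] idealizerD(4) [OF N(2) diagonalI [OF a]] d(2)
    by simp_all
  then show "\<lbrace>q,i' a\<rbrace>\<^bsub>A'\<^esub> = \<lbrace>q',i' a\<rbrace>\<^bsub>A'\<^esub>"
    using diagonal_unique [OF _ d(1)] by metis
qed (use assms idealizer_closed that in auto)

text \<open>The map \<open>u l(x) \<mapsto> u l'(x)\<close>; the inverse of \<open>i\<close> recovers \<open>u\<close>.\<close>

definition partner :: "'e \<Rightarrow> 'f" where
  "partner p = i' (inv_into (carrier I) i (p \<otimes>\<^bsub>A\<^esub> inv\<^bsub>A\<^esub> (l (pr p)))) \<otimes>\<^bsub>A'\<^esub> l' (pr p)"

lemma partner_eq: "\<lbrakk>u \<in> carrier I; x \<in> carrier Q\<rbrakk> \<Longrightarrow> partner (i u \<otimes>\<^bsub>A\<^esub> l x) = i' u \<otimes>\<^bsub>A'\<^esub> l' x"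
  by (simp add: partner_def E.m_assoc E.i_inj inv_into_f_f)

lemma partner_l: "x \<in> carrier Q \<Longrightarrow> partner (l x) = l' x"
  using partner_eq [of "\<one>\<^bsub>I\<^esub>" x] by simp

lemma partner_i: "u \<in> carrier I \<Longrightarrow> partner (i u) = i' u"
  using partner_eq [of u "\<one>\<^bsub>Q\<^esub>"] by (simp add: E.l_one E'.l_one)

lemma partner_i_mult:
  assumes "u \<in> carrier I" "p \<in> carrier A"
  shows "partner (i u \<otimes>\<^bsub>A\<^esub> p) = i' u \<otimes>\<^bsub>A'\<^esub> partner p"
proof -
  obtain v where v: "v \<in> carrier I" "p = i v \<otimes>\<^bsub>A\<^esub> l (pr p)" using E.over_section assms by blast
  define x where "x = pr p"
  have x: "x \<in> carrier Q" "p = i v \<otimes>\<^bsub>A\<^esub> l x" using v assms by (simp_all add: x_def)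
  have "i u \<otimes>\<^bsub>A\<^esub> p = i (u \<otimes>\<^bsub>I\<^esub> v) \<otimes>\<^bsub>A\<^esub> l x" using x v(1) assms(1) by (simp add: E.m_assoc)
  then show ?thesis
    using x v(1) assms(1) by (simp add: partner_eq E'.m_assoc del: E.i_mult)
qed

lemma partner_closed [simp]: "p \<in> carrier A \<Longrightarrow> partner p \<in> carrier A'"
  and pr_partner [simp]: "p \<in> carrier A \<Longrightarrow> pr' (partner p) = pr p"
  and partner_idealizer: "p \<in> carrier A \<Longrightarrow> (p, partner p) \<in> idealizer M diagonal"
proof -
  assume p: "p \<in> carrier A"
  obtain v where v: "v \<in> carrier I" "p = i v \<otimes>\<^bsub>A\<^esub> l (pr p)" using E.over_section p by blast
  define x where "x = pr p"
  have x: "x \<in> carrier Q" "p = i v \<otimes>\<^bsub>A\<^esub> l x" using v p by (simp_all add: x_def)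
  have \<phi>: "partner p = i' v \<otimes>\<^bsub>A'\<^esub> l' x" using x v(1) by (simp add: partner_eq)
  show "partner p \<in> carrier A'" "pr' (partner p) = pr p"
    unfolding \<phi> using x(1) v(1) by (simp_all add: x_def)
  have "(i v, i' v) \<in> idealizer M diagonal"
    using M.subalgebra_subset_idealizer [OF diagonal_subalgebra] diagonalI [OF v(1)] by blast
  then have "(i v, i' v) \<otimes>\<^bsub>M\<^esub> (l x, l' x) \<in> idealizer M diagonal"
    by (rule M.idealizer_mult [OF diagonal_subalgebra _ section_in_idealizer [OF x(1)]])
  then show "(p, partner p) \<in> idealizer M diagonal" using \<phi> x(2) by simp
qed

lemma partner_bij: "bij_betw partner (carrier A) (carrier A')"
proof (rule bij_betw_imageI)
  show "inj_on partner (carrier A)"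
  proof (rule inj_onI)
    fix p q assume pq: "p \<in> carrier A" "q \<in> carrier A" "partner p = partner q"
    then have "pr p = pr q" using pr_partner by metis
    then obtain u where u: "u \<in> carrier I" "p = i u \<otimes>\<^bsub>A\<^esub> q" using E.same_fibre pq by metis
    then have "partner q = i' u \<otimes>\<^bsub>A'\<^esub> partner q" using pq by (simp add: partner_i_mult)
    then have "i' u = i' \<one>\<^bsub>I\<^esub>" using pq u(1) by simp
    then have "u = \<one>\<^bsub>I\<^esub>" using u(1) by (simp del: E'.i_one)
    then show "p = q" using u pq by simp
  qed
  show "partner ` carrier A = carrier A'"
  proof
    show "carrier A' \<subseteq> partner ` carrier A"
    proof
      fix q assume q: "q \<in> carrier A'"
      obtain u where u: "u \<in> carrier I" "q = i' u \<otimes>\<^bsub>A'\<^esub> l' (pr' q)" using E'.over_section q by blast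
      then show "q \<in> partner ` carrier A"
        using q by (intro image_eqI [of _ _ "i u \<otimes>\<^bsub>A\<^esub> l (pr' q)"]) (simp_all add: partner_eq)
    qed
  qed auto
qed

text \<open>The difference of the two factor sets: how far \<open>partner\<close> is from a homomorphism.\<close>

definition difference :: "('q, 'i) cochain" where
  "difference =
    (\<lambda>x y. SOME w. w \<in> alg_center I \<and>
       l' x \<otimes>\<^bsub>A'\<^esub> l' y = i' w \<otimes>\<^bsub>A'\<^esub> partner (l x \<otimes>\<^bsub>A\<^esub> l y),
     \<lambda>x y. SOME w. w \<in> alg_center I \<and>
       \<lbrace>l' x,l' y\<rbrace>\<^bsub>A'\<^esub> = i' w \<otimes>\<^bsub>A'\<^esub> partner \<lbrace>l x,l y\<rbrace>\<^bsub>A\<^esub>)"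

lemma difference_mult:
  assumes x: "x \<in> carrier Q" "y \<in> carrier Q"
  shows "fst difference x y \<in> alg_center I \<and>
    l' x \<otimes>\<^bsub>A'\<^esub> l' y = i' (fst difference x y) \<otimes>\<^bsub>A'\<^esub> partner (l x \<otimes>\<^bsub>A\<^esub> l y)"
proof -
  have "(l x, l' x) \<otimes>\<^bsub>M\<^esub> (l y, l' y) \<in> idealizer M diagonal"
    by (rule M.idealizer_mult [OF diagonal_subalgebra section_in_idealizer section_in_idealizer])
      (rule x)+
  then have "(l x \<otimes>\<^bsub>A\<^esub> l y, l' x \<otimes>\<^bsub>A'\<^esub> l' y) \<in> idealizer M diagonal" by simp
  then obtain w where "w \<in> alg_center I" "l' x \<otimes>\<^bsub>A'\<^esub> l' y = i' w \<otimes>\<^bsub>A'\<^esub> partner (l x \<otimes>\<^bsub>A\<^esub> l y)"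
    by (rule partners_differ_by_Z [OF _ partner_idealizer]) (use x in simp_all)
  then have "\<exists>w. w \<in> alg_center I \<and> l' x \<otimes>\<^bsub>A'\<^esub> l' y = i' w \<otimes>\<^bsub>A'\<^esub> partner (l x \<otimes>\<^bsub>A\<^esub> l y)" by blast
  then show ?thesis unfolding difference_def fst_conv by (rule someI_ex)
qed

lemma difference_bracket:
  assumes x: "x \<in> carrier Q" "y \<in> carrier Q"
  shows "snd difference x y \<in> alg_center I \<and>
    \<lbrace>l' x,l' y\<rbrace>\<^bsub>A'\<^esub> = i' (snd difference x y) \<otimes>\<^bsub>A'\<^esub> partner \<lbrace>l x,l y\<rbrace>\<^bsub>A\<^esub>"
proof -
  have "\<lbrace>(l x, l' x),(l y, l' y)\<rbrace>\<^bsub>M\<^esub> \<in> idealizer M diagonal"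
    by (rule M.idealizer_bracket [OF diagonal_subalgebra section_in_idealizer section_in_idealizer])
      (rule x)+
  then have "(\<lbrace>l x,l y\<rbrace>\<^bsub>A\<^esub>, \<lbrace>l' x,l' y\<rbrace>\<^bsub>A'\<^esub>) \<in> idealizer M diagonal" by simp
  then obtain w where "w \<in> alg_center I" "\<lbrace>l' x,l' y\<rbrace>\<^bsub>A'\<^esub> = i' w \<otimes>\<^bsub>A'\<^esub> partner \<lbrace>l x,l y\<rbrace>\<^bsub>A\<^esub>"
    by (rule partners_differ_by_Z [OF _ partner_idealizer]) (use x in simp_all)
  then have "\<exists>w. w \<in> alg_center I \<and> \<lbrace>l' x,l' y\<rbrace>\<^bsub>A'\<^esub> = i' w \<otimes>\<^bsub>A'\<^esub> partner \<lbrace>l x,l y\<rbrace>\<^bsub>A\<^esub>" by blast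
  then show ?thesis unfolding difference_def snd_conv by (rule someI_ex)
qed

lemma difference_cocycle: "two_cocycle Q (center_algebra I) difference"
proof -
  have trivial: "w = \<one>\<^bsub>I\<^esub>" if "w \<in> alg_center I \<and> q = i' w \<otimes>\<^bsub>A'\<^esub> q" "q \<in> carrier A'" for w q
  proof -
    have w: "w \<in> carrier I" using that by simp
    have "i' w \<otimes>\<^bsub>A'\<^esub> q = q" using that by simp
    then have "i' w = i' \<one>\<^bsub>I\<^esub>" using that(2) w by simp
    then show ?thesis using w by (simp del: E'.i_one)
  qed
  have one: "partner \<one>\<^bsub>A\<^esub> = \<one>\<^bsub>A'\<^esub>" using partner_i [of "\<one>\<^bsub>I\<^esub>"] by simp
  have "fst difference x \<one>\<^bsub>Q\<^esub> = \<one>\<^bsub>I\<^esub>" "fst difference \<one>\<^bsub>Q\<^esub> x = \<one>\<^bsub>I\<^esub>" if x: "x \<in> carrier Q" for x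
  proof -
    show "fst difference x \<one>\<^bsub>Q\<^esub> = \<one>\<^bsub>I\<^esub>"
      by (rule trivial [of _ "l' x"])
        (use difference_mult [OF x E.Q.one_closed] x in \<open>simp_all add: E.l_one E'.l_one partner_l\<close>)
    show "fst difference \<one>\<^bsub>Q\<^esub> x = \<one>\<^bsub>I\<^esub>"
      by (rule trivial [of _ "l' x"])
        (use difference_mult [OF E.Q.one_closed x] x in \<open>simp_all add: E.l_one E'.l_one partner_l\<close>)
  qed
  moreover have "snd difference x y = \<one>\<^bsub>I\<^esub>"
    if "x \<in> carrier Q" "y \<in> carrier Q" "x = y \<or> x = \<one>\<^bsub>Q\<^esub> \<or> y = \<one>\<^bsub>Q\<^esub>" for x y
  proof -
    have "\<lbrace>l x,l y\<rbrace>\<^bsub>A\<^esub> = \<one>\<^bsub>A\<^esub>" "\<lbrace>l' x,l' y\<rbrace>\<^bsub>A'\<^esub> = \<one>\<^bsub>A'\<^esub>"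
      using that by (auto simp: E.l_one E'.l_one)
    then show ?thesis
      using difference_bracket [OF that(1,2)] by (intro trivial [of _ "\<one>\<^bsub>A'\<^esub>"]) (simp_all add: one)
  qed
  ultimately show ?thesis
    using difference_mult difference_bracket by (auto simp: two_cocycle_def case_prod_unfold)
qed

text \<open>
  The difference depends on the fibres only: changing \<open>(l(x), l'(x))\<close> by a diagonal factor changes
  products and brackets in the idealizer by a diagonal factor, under which \<open>partner\<close> is equivariant.
\<close>

lemma partner_operations:
  assumes p: "p \<in> carrier A" "q \<in> carrier A"
  shows "partner p \<otimes>\<^bsub>A'\<^esub> partner q = i' (fst difference (pr p) (pr q)) \<otimes>\<^bsub>A'\<^esub> partner (p \<otimes>\<^bsub>A\<^esub> q)"
    and "\<lbrace>partner p,partner q\<rbrace>\<^bsub>A'\<^esub> = i' (snd difference (pr p) (pr q)) \<otimes>\<^bsub>A'\<^esub> partner \<lbrace>p,q\<rbrace>\<^bsub>A\<^esub>"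
proof -
  obtain u where u: "u \<in> carrier I" "p = i u \<otimes>\<^bsub>A\<^esub> l (pr p)" using E.over_section p by blast
  obtain v where v: "v \<in> carrier I" "q = i v \<otimes>\<^bsub>A\<^esub> l (pr q)" using E.over_section p by blast
  define x y where "x = pr p" and "y = pr q"
  have x: "x \<in> carrier Q" "p = i u \<otimes>\<^bsub>A\<^esub> l x" and y: "y \<in> carrier Q" "q = i v \<otimes>\<^bsub>A\<^esub> l y"
    using u v p by (simp_all add: x_def y_def)
  have ph: "partner p = i' u \<otimes>\<^bsub>A'\<^esub> l' x" "partner q = i' v \<otimes>\<^bsub>A'\<^esub> l' y"
    using x y u(1) v(1) by (simp_all add: partner_eq)
  note N = section_in_idealizer [OF x(1)] section_in_idealizer [OF y(1)]
  have S: "fst difference x y \<in> alg_center I" "snd difference x y \<in> alg_center I"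
    using difference_mult difference_bracket x y by auto
  obtain c where c: "c \<in> diagonal" "((i u, i' u) \<otimes>\<^bsub>M\<^esub> (l x, l' x)) \<otimes>\<^bsub>M\<^esub> ((i v, i' v) \<otimes>\<^bsub>M\<^esub> (l y, l' y))
      = c \<otimes>\<^bsub>M\<^esub> ((l x, l' x) \<otimes>\<^bsub>M\<^esub> (l y, l' y))"
    by (rule M.idealizer_mult_coset [OF diagonal_subalgebra N diagonalI [OF u(1)] diagonalI [OF v(1)]])
  then obtain a where a: "a \<in> carrier I" "c = (i a, i' a)" by (auto simp: diagonal_def)
  have pq: "p \<otimes>\<^bsub>A\<^esub> q = i a \<otimes>\<^bsub>A\<^esub> (l x \<otimes>\<^bsub>A\<^esub> l y)"
      "partner p \<otimes>\<^bsub>A'\<^esub> partner q = i' a \<otimes>\<^bsub>A'\<^esub> (l' x \<otimes>\<^bsub>A'\<^esub> l' y)"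
    using c(2) unfolding a(2) ph unfolding x(2) y(2) by simp_all
  have "partner p \<otimes>\<^bsub>A'\<^esub> partner q =
      i' a \<otimes>\<^bsub>A'\<^esub> (i' (fst difference x y) \<otimes>\<^bsub>A'\<^esub> partner (l x \<otimes>\<^bsub>A\<^esub> l y))"
    unfolding pq(2) using difference_mult x(1) y(1) by simp
  also have "\<dots> = i' (fst difference x y) \<otimes>\<^bsub>A'\<^esub> (i' a \<otimes>\<^bsub>A'\<^esub> partner (l x \<otimes>\<^bsub>A\<^esub> l y))"
    using a(1) x(1) y(1) S E'.Z_i_comm [OF S(1) a(1)] by (simp flip: E'.m_assoc)
  also have "i' a \<otimes>\<^bsub>A'\<^esub> partner (l x \<otimes>\<^bsub>A\<^esub> l y) = partner (p \<otimes>\<^bsub>A\<^esub> q)"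
    unfolding pq(1) using a(1) x(1) y(1) by (simp add: partner_i_mult)
  finally show "partner p \<otimes>\<^bsub>A'\<^esub> partner q =
      i' (fst difference (pr p) (pr q)) \<otimes>\<^bsub>A'\<^esub> partner (p \<otimes>\<^bsub>A\<^esub> q)"
    by (simp add: x_def y_def)
  obtain d where d: "d \<in> diagonal" "\<lbrace>(i u, i' u) \<otimes>\<^bsub>M\<^esub> (l x, l' x),(i v, i' v) \<otimes>\<^bsub>M\<^esub> (l y, l' y)\<rbrace>\<^bsub>M\<^esub>
      = d \<otimes>\<^bsub>M\<^esub> \<lbrace>(l x, l' x),(l y, l' y)\<rbrace>\<^bsub>M\<^esub>"
    by (rule M.idealizer_bracket_coset [OF diagonal_subalgebra N diagonalI [OF u(1)] diagonalI [OF v(1)]])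
  then obtain b where b: "b \<in> carrier I" "d = (i b, i' b)" by (auto simp: diagonal_def)
  have pq': "\<lbrace>p,q\<rbrace>\<^bsub>A\<^esub> = i b \<otimes>\<^bsub>A\<^esub> \<lbrace>l x,l y\<rbrace>\<^bsub>A\<^esub>"
      "\<lbrace>partner p,partner q\<rbrace>\<^bsub>A'\<^esub> = i' b \<otimes>\<^bsub>A'\<^esub> \<lbrace>l' x,l' y\<rbrace>\<^bsub>A'\<^esub>"
    using d(2) unfolding b(2) ph unfolding x(2) y(2) by simp_all
  have "\<lbrace>partner p,partner q\<rbrace>\<^bsub>A'\<^esub> =
      i' b \<otimes>\<^bsub>A'\<^esub> (i' (snd difference x y) \<otimes>\<^bsub>A'\<^esub> partner \<lbrace>l x,l y\<rbrace>\<^bsub>A\<^esub>)"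
    unfolding pq'(2) using difference_bracket x(1) y(1) by simp
  also have "\<dots> = i' (snd difference x y) \<otimes>\<^bsub>A'\<^esub> (i' b \<otimes>\<^bsub>A'\<^esub> partner \<lbrace>l x,l y\<rbrace>\<^bsub>A\<^esub>)"
    using b(1) x(1) y(1) S E'.Z_i_comm [OF S(2) b(1)] by (simp flip: E'.m_assoc)
  also have "i' b \<otimes>\<^bsub>A'\<^esub> partner \<lbrace>l x,l y\<rbrace>\<^bsub>A\<^esub> = partner \<lbrace>p,q\<rbrace>\<^bsub>A\<^esub>"
    unfolding pq'(1) using b(1) x(1) y(1) by (simp add: partner_i_mult)
  finally show "\<lbrace>partner p,partner q\<rbrace>\<^bsub>A'\<^esub> =
      i' (snd difference (pr p) (pr q)) \<otimes>\<^bsub>A'\<^esub> partner \<lbrace>p,q\<rbrace>\<^bsub>A\<^esub>"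
    by (simp add: x_def y_def)
qed

lemma partner_iso: "partner \<in> mla_iso (E.twist difference) A'"
proof (rule mla_isoI)
  show "bij_betw partner (carrier (E.twist difference)) (carrier A')" using partner_bij by simp
  fix p q assume "p \<in> carrier (E.twist difference)" "q \<in> carrier (E.twist difference)"
  then have p: "p \<in> carrier A" "q \<in> carrier A" by simp_all
  have S: "fst difference (pr p) (pr q) \<in> alg_center I" "snd difference (pr p) (pr q) \<in> alg_center I"
    using difference_mult difference_bracket p by auto
  show "partner (p \<otimes>\<^bsub>E.twist difference\<^esub> q) = partner p \<otimes>\<^bsub>A'\<^esub> partner q"
    using p S by (simp add: partner_operations partner_i_mult)
  show "partner \<lbrace>p,q\<rbrace>\<^bsub>E.twist difference\<^esub> = \<lbrace>partner p,partner q\<rbrace>\<^bsub>A'\<^esub>"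
    using p S by (simp add: partner_operations partner_i_mult)
qed

text \<open>The twist is the algebra structure of \<open>A'\<close> transported along the inverse of \<open>partner\<close>.\<close>

lemma difference_compatible: "difference \<in> E.cocycles"
proof (rule E.cocycle_of_twist_mla [OF difference_cocycle])
  let ?g = "inv_into (carrier A) partner"
  have inj: "inj_on partner (carrier A)" and im: "partner ` carrier A = carrier A'"
    using partner_bij by (simp_all add: bij_betw_def)
  have g: "?g (partner p) = p" if "p \<in> carrier A" for p using inj that by simp
  show "multiplicative_lie_algebra (E.twist difference)"
  proof (rule image_mla [OF E'.multiplicative_lie_algebra_axioms, of ?g])
    show "?g ` carrier A' = carrier (E.twist difference)"
      using bij_betw_inv_into [OF partner_bij] by (simp add: bij_betw_def)
    show "?g \<one>\<^bsub>A'\<^esub> = \<one>\<^bsub>E.twist difference\<^esub>"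
      using g [of "\<one>\<^bsub>A\<^esub>"] partner_i [of "\<one>\<^bsub>I\<^esub>"] by simp
  next
    fix a b assume "a \<in> carrier A'" "b \<in> carrier A'"
    then obtain p q where p: "p \<in> carrier A" "a = partner p" and q: "q \<in> carrier A" "b = partner q"
      using im by blast
    have S: "fst difference (pr p) (pr q) \<in> alg_center I" "snd difference (pr p) (pr q) \<in> alg_center I"
      using difference_mult difference_bracket p q by auto
    have c: "p \<otimes>\<^bsub>E.twist difference\<^esub> q \<in> carrier A" "\<lbrace>p,q\<rbrace>\<^bsub>E.twist difference\<^esub> \<in> carrier A"
      using p q S by simp_all
    have "a \<otimes>\<^bsub>A'\<^esub> b = partner (p \<otimes>\<^bsub>E.twist difference\<^esub> q)" "\<lbrace>a,b\<rbrace>\<^bsub>A'\<^esub> = partner \<lbrace>p,q\<rbrace>\<^bsub>E.twist difference\<^esub>"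
      using mla_isoD(3,4) [OF partner_iso, of p q] p q by simp_all
    then show "?g a \<otimes>\<^bsub>E.twist difference\<^esub> ?g b = ?g (a \<otimes>\<^bsub>A'\<^esub> b)"
        "\<lbrace>?g a,?g b\<rbrace>\<^bsub>E.twist difference\<^esub> = ?g \<lbrace>a,b\<rbrace>\<^bsub>A'\<^esub>"
      using g p q c by simp_all
  qed
qed

end

lemma equivalent_to_twist:
  fixes A A' :: "'e mult_lie"
  assumes R: "realization Q I A i pr \<chi> l" and R': "realization Q I A' i' pr' \<chi> l'"
    and F: "total F = A'" "incl F = i'" "proj F = pr'"
  shows "\<exists>S \<in> compatible_cocycles Q (center_algebra I) (restrict_terms \<chi> (alg_center I)).
    (realization.twist_ext A i pr S, F) \<in> ext_rel Q I"
proof -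
  interpret two_realizations Q I A i pr \<chi> l A' i' pr' l'
    using R R' by (rule two_realizations.intro)
  have "is_extension Q I (E.twist_ext difference)"
    by (rule realization.realization_is_extension [OF E.twist_realization [OF difference_compatible]])
      simp_all
  moreover have "is_extension Q I F" using F by (rule E'.realization_is_extension)
  ultimately have "(E.twist_ext difference, F) \<in> ext_rel Q I"
    using bexI [of _ partner, OF _ partner_iso] by (simp add: ext_rel_def F partner_i)
  then show ?thesis using difference_compatible by blast
qed

section \<open>Sections with prescribed action terms\<close>

lemma realization_of_section:
  fixes Q :: "'q mult_lie" and I :: "'i mult_lie" and E :: "('i, 'e, 'q) extension"
  assumes Q: "multiplicative_lie_algebra Q" and I: "multiplicative_lie_algebra I"
    and E: "is_extension Q I E" and l: "is_section Q E l"
  shows "realization Q I (total E) (incl E) (proj E) (section_terms I E l) l"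
proof -
  interpret Q: multiplicative_lie_algebra Q by (rule Q)
  interpret I: multiplicative_lie_algebra I by (rule I)
  interpret A: multiplicative_lie_algebra "total E" using E by (simp add: is_extension_def)
  define i pr where "i = incl E" and "pr = proj E"
  have i_closed [simp]: "a \<in> carrier I \<Longrightarrow> i a \<in> carrier (total E)"
    and i_mult: "\<lbrakk>a \<in> carrier I; b \<in> carrier I\<rbrakk> \<Longrightarrow> i (a \<otimes>\<^bsub>I\<^esub> b) = i a \<otimes>\<^bsub>total E\<^esub> i b"
    and i_bracket: "\<lbrakk>a \<in> carrier I; b \<in> carrier I\<rbrakk> \<Longrightarrow> i \<lbrace>a,b\<rbrace>\<^bsub>I\<^esub> = \<lbrace>i a,i b\<rbrace>\<^bsub>total E\<^esub>" for a b
    using E by (auto simp: is_extension_def mla_hom_def hom_def i_def)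
  have inj: "inj_on i (carrier I)" and ker: "i ` carrier I = kernel (total E) Q pr"
    and pr_hom: "pr \<in> hom (total E) Q"
    and pr_bracket: "\<lbrakk>p \<in> carrier (total E); q \<in> carrier (total E)\<rbrakk> \<Longrightarrow>
      pr \<lbrace>p,q\<rbrace>\<^bsub>total E\<^esub> = \<lbrace>pr p,pr q\<rbrace>\<^bsub>Q\<^esub>" for p q
    using E by (auto simp: is_extension_def mla_hom_def i_def pr_def)
  interpret pr: group_hom "total E" Q pr
    using pr_hom by unfold_locales
  have pr_i [simp]: "pr (i a) = \<one>\<^bsub>Q\<^esub>" if "a \<in> carrier I" for a
    using ker that by (auto simp: kernel_def)
  have kernel: "\<exists>a\<in>carrier I. p = i a" if "p \<in> carrier (total E)" "pr p = \<one>\<^bsub>Q\<^esub>" for p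
  proof -
    have "p \<in> i ` carrier I" unfolding ker using that by (simp add: kernel_def)
    then show ?thesis by blast
  qed
  have lx [simp]: "l x \<in> carrier (total E)" "pr (l x) = x" if "x \<in> carrier Q" for x
    using l that by (auto simp: is_section_def pr_def)
  define j where "j = inv_into (carrier I) i"
  have j: "j p \<in> carrier I" "i (j p) = p" if "p \<in> carrier (total E)" "pr p = \<one>\<^bsub>Q\<^esub>" for p
    using kernel [OF that] inj by (auto simp: j_def)
  have terms: "sigma (section_terms I E l) x a = j (conjugate (total E) (i a) (l x))"
    "tau (section_terms I E l) x a = j \<lbrace>l x,i a\<rbrace>\<^bsub>total E\<^esub>"
    "nu (section_terms I E l) x a = j \<lbrace>i a,l x\<rbrace>\<^bsub>total E\<^esub>" for x a
    by (simp_all add: section_terms_def Let_def conjugate_def i_def j_def)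
  have in_kernel: "pr (conjugate (total E) (i a) (l x)) = \<one>\<^bsub>Q\<^esub>"
    "pr \<lbrace>l x,i a\<rbrace>\<^bsub>total E\<^esub> = \<one>\<^bsub>Q\<^esub>" "pr \<lbrace>i a,l x\<rbrace>\<^bsub>total E\<^esub> = \<one>\<^bsub>Q\<^esub>"
    if "x \<in> carrier Q" "a \<in> carrier I" for x a
    using that by (simp_all add: conjugate_def pr_bracket)
  have "realization Q I (total E) i pr (section_terms I E l) l"
    by unfold_locales
      (use l in \<open>simp_all add: i_mult i_bracket inj pr_bracket kernel terms in_kernel j is_section_def\<close>)
  then show ?thesis by (simp add: i_def pr_def)
qed

lemma realization_same_terms:
  assumes "realization Q I A i pr \<chi> l" and same: "same_terms Q I \<chi>' \<chi>"
  shows "realization Q I A i pr \<chi>' l"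
proof -
  interpret realization Q I A i pr \<chi> l by fact
  have [simp]: "sigma \<chi>' x a = sigma \<chi> x a" "tau \<chi>' x a = tau \<chi> x a" "nu \<chi>' x a = nu \<chi> x a"
    if "x \<in> carrier Q" "a \<in> carrier I" for x a
    using same that by (simp_all add: same_terms_def)
  show ?thesis
    by unfold_locales
      (simp_all add: i_inj kernel_pr l_one conjugate_l bracket_l_left bracket_l_right)
qed

text \<open>
  If the terms of \<open>l'\<close> are equivalent to \<open>\<chi>\<close> through \<open>h\<close>, then \<open>x \<mapsto> h(x)\<inverse> l'(x)\<close> has exactly
  the terms \<open>\<chi>\<close>. A section must be normalized, whence the separate value at \<open>1\<close>, where \<open>\<chi>\<close> is trivial.
\<close>

lemma realization_equiv_terms:
  fixes \<chi> \<chi>' :: "('q, 'i) action_terms"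
  assumes R: "realization Q I A i pr \<chi> l" and R': "realization Q I A' i' pr' \<chi>' l'"
    and equiv: "equiv_terms Q I \<chi>' \<chi>"
  shows "\<exists>m. realization Q I A' i' pr' \<chi> m"
proof -
  interpret E: realization Q I A i pr \<chi> l by (rule R)
  interpret E': realization Q I A' i' pr' \<chi>' l' by (rule R')
  obtain h where h: "h \<in> carrier Q \<rightarrow> carrier I"
    and eq: "\<And>x a. \<lbrakk>x \<in> carrier Q; a \<in> carrier I\<rbrakk> \<Longrightarrow>
     sigma \<chi>' x a = h x \<otimes>\<^bsub>I\<^esub> sigma \<chi> x a \<otimes>\<^bsub>I\<^esub> inv\<^bsub>I\<^esub> (h x) \<and>
     tau \<chi>' x a = conjugate I (tau \<chi> x a) (h x) \<otimes>\<^bsub>I\<^esub> \<lbrace>h x,a\<rbrace>\<^bsub>I\<^esub> \<and>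
     nu \<chi>' x a = \<lbrace>a,h x\<rbrace>\<^bsub>I\<^esub> \<otimes>\<^bsub>I\<^esub> conjugate I (nu \<chi> x a) (h x)"
    using equiv by (auto simp: equiv_terms_def)
  have hI [simp]: "h x \<in> carrier I" if "x \<in> carrier Q" for x using h that by auto
  define m where "m x = (if x = \<one>\<^bsub>Q\<^esub> then \<one>\<^bsub>A'\<^esub> else inv\<^bsub>A'\<^esub> (i' (h x)) \<otimes>\<^bsub>A'\<^esub> l' x)" for x
  have i'_conj: "i' (conjugate I a b) = conjugate A' (i' a) (i' b)"
    if "a \<in> carrier I" "b \<in> carrier I" for a b
    using that by (simp add: conjugate_def)
  have m_one: "m \<one>\<^bsub>Q\<^esub> = \<one>\<^bsub>A'\<^esub>" by (simp add: m_def)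
  have m_closed [simp]: "m x \<in> carrier A'" and pr_m [simp]: "pr' (m x) = x"
    if "x \<in> carrier Q" for x
    using that by (auto simp: m_def)
  have terms: "conjugate A' (i' a) (m x) = i' (sigma \<chi> x a) \<and>
      \<lbrace>m x,i' a\<rbrace>\<^bsub>A'\<^esub> = i' (tau \<chi> x a) \<and> \<lbrace>i' a,m x\<rbrace>\<^bsub>A'\<^esub> = i' (nu \<chi> x a)"
    if x: "x \<in> carrier Q" and a: "a \<in> carrier I" for x a
  proof (cases "x = \<one>\<^bsub>Q\<^esub>")
    case True
    then show ?thesis using a by (simp add: m_one E.terms_one)
  next
    case False
    note e = eq [OF x a]
    have l': "l' x = i' (h x) \<otimes>\<^bsub>A'\<^esub> m x"
      using False x by (simp add: m_def E'.cancel_inv_right)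
    have "conjugate A' (conjugate A' (i' a) (m x)) (i' (h x)) = i' (sigma \<chi>' x a)"
      using x a by (simp add: l' E'.conjugate_by_mult flip: E'.conjugate_l)
    also have "\<dots> = conjugate A' (i' (sigma \<chi> x a)) (i' (h x))"
      by (subst conjunct1 [OF e]) (use x a in \<open>simp add: conjugate_def\<close>)
    finally have "conjugate A' (conjugate A' (i' a) (m x)) (i' (h x)) =
      conjugate A' (i' (sigma \<chi> x a)) (i' (h x))" .
    then have 1: "conjugate A' (i' a) (m x) = i' (sigma \<chi> x a)"
      using x a by (simp add: conjugate_def)
    have "conjugate A' \<lbrace>m x,i' a\<rbrace>\<^bsub>A'\<^esub> (i' (h x)) \<otimes>\<^bsub>A'\<^esub> \<lbrace>i' (h x),i' a\<rbrace>\<^bsub>A'\<^esub> =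
        conjugate A' (i' (tau \<chi> x a)) (i' (h x)) \<otimes>\<^bsub>A'\<^esub> \<lbrace>i' (h x),i' a\<rbrace>\<^bsub>A'\<^esub>"
    proof -
      have "conjugate A' \<lbrace>m x,i' a\<rbrace>\<^bsub>A'\<^esub> (i' (h x)) \<otimes>\<^bsub>A'\<^esub> \<lbrace>i' (h x),i' a\<rbrace>\<^bsub>A'\<^esub> = i' (tau \<chi>' x a)"
        using x a by (simp add: l' E'.bracket_mult_left flip: E'.bracket_l_left)
      then show ?thesis using e x a by (simp add: i'_conj)
    qed
    then have 2: "\<lbrace>m x,i' a\<rbrace>\<^bsub>A'\<^esub> = i' (tau \<chi> x a)"
      using x a by (simp add: conjugate_def)
    have "\<lbrace>i' a,i' (h x)\<rbrace>\<^bsub>A'\<^esub> \<otimes>\<^bsub>A'\<^esub> conjugate A' \<lbrace>i' a,m x\<rbrace>\<^bsub>A'\<^esub> (i' (h x)) =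
        \<lbrace>i' a,i' (h x)\<rbrace>\<^bsub>A'\<^esub> \<otimes>\<^bsub>A'\<^esub> conjugate A' (i' (nu \<chi> x a)) (i' (h x))"
    proof -
      have "\<lbrace>i' a,i' (h x)\<rbrace>\<^bsub>A'\<^esub> \<otimes>\<^bsub>A'\<^esub> conjugate A' \<lbrace>i' a,m x\<rbrace>\<^bsub>A'\<^esub> (i' (h x)) = i' (nu \<chi>' x a)"
        using x a by (simp add: l' E'.bracket_mult_right flip: E'.bracket_l_right)
      then show ?thesis using e x a by (simp add: i'_conj)
    qed
    then have 3: "\<lbrace>i' a,m x\<rbrace>\<^bsub>A'\<^esub> = i' (nu \<chi> x a)"
      using x a by (simp add: conjugate_def)
    show ?thesis using 1 2 3 by blast
  qed
  have "realization Q I A' i' pr' \<chi> m"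
    by unfold_locales (simp_all add: E'.i_inj E'.kernel_pr m_one terms)
  then show ?thesis by blast
qed

section \<open>The correspondence between cohomology and extensions\<close>

theorem theorem3p30:
  fixes Q :: "'q mult_lie"
    and I :: "'i mult_lie"
    and \<chi> :: "('q, 'i) action_terms"
  assumes "multiplicative_lie_algebra Q"
    and "multiplicative_lie_algebra I"
    and "is_action_terms Q I \<chi>"
    and "\<exists>E :: ('i, 'e, 'q) extension. is_extension Q I E \<and> realizes_terms Q I \<chi> E"
  shows "\<exists>\<Phi>. bij_betw \<Phi>
           (carrier (H2 Q (center_algebra I) (restrict_terms \<chi> (alg_center I))))
           (Ext Q I \<chi> :: ('i, 'e, 'q) extension set set)"
proof -
  obtain E :: "('i, 'e, 'q) extension" and l where E: "is_extension Q I E"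
    and l: "is_section Q E l" "same_terms Q I \<chi> (section_terms I E l)"
    using assms(4) by (auto simp: realizes_terms_def)
  have R: "realization Q I (total E) (incl E) (proj E) \<chi> l"
    by (rule realization_same_terms [OF realization_of_section [OF assms(1,2) E l(1)] l(2)])
  interpret E: realization Q I "total E" "incl E" "proj E" \<chi> l by (rule R)
  let ?X = "{F :: ('i, 'e, 'q) extension. is_extension Q I F \<and> realizes_class Q I \<chi> F}"
  have onto: "\<exists>S\<in>E.cocycles. (E.twist_ext S, F) \<in> ext_rel Q I" if F: "F \<in> ?X" for F
  proof -
    obtain l' where l': "is_section Q F l'" "equiv_terms Q I (section_terms I F l') \<chi>"
      using F by (auto simp: realizes_class_def)
    have "realization Q I (total F) (incl F) (proj F) (section_terms I F l') l'"
      using F by (intro realization_of_section [OF assms(1,2) _ l'(1)]) simp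
    then obtain m where "realization Q I (total F) (incl F) (proj F) \<chi> m"
      using realization_equiv_terms [OF R _ l'(2)] by blast
    then show ?thesis using equivalent_to_twist [OF R] by blast
  qed
  have "bij_betw (\<lambda>c. ext_rel Q I `` (E.twist_ext ` c))
      (E.cocycles // cohomologous Q E.B (restrict_terms \<chi> E.Z)) (?X // ext_rel Q I)"
  proof (rule bij_betw_quotients [OF equiv_ext_rel])
    show "E.twist_ext S \<in> ?X" if "S \<in> E.cocycles" for S
      using realization.realization_is_extension [OF E.twist_realization [OF that]]
        realization.realization_realizes_class [OF E.twist_realization [OF that]] by simp
  qed (use E.cohomologous_iff onto in auto)
  then show ?thesis by (auto simp: H2_def Ext_def)
qed

end
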